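(* Let $(X,T)$ be Ohno's subshift and, for a roof function $\gamma:X_*\to(0,+\infty)$, let $(X^\gamma,\Phi^\gamma)$ be the associated suspension flow compactified by one fixed point (all as defined in the context). For every real number $b$ with $0<b<+\infty$ there exists a roof function $\gamma:X_*\to(0,+\infty)$ such that the associated flow $(X^\gamma,\Phi^\gamma)$ satisfies $h(\Phi^\gamma)=b$.
   Context: Entropy of flows. A flow on a compact metric space $Z$ is a continuous map $\phi:Z\times\mathbb R\to Z$ with $\phi_0=\mathrm{id}$ and $\phi_t\circ\phi_s=\phi_{t+s}$, where $\phi_t=\phi(\cdot,t)$. The topological entropy of the flow is $h(\phi)=h(\phi_1)$. Ohno's subshift. Let $\Sigma(2)=\{0,1\}^{\mathbb Z}$ with the product topology and $T$ the shift $(x_i)\mapsto(x_{i+1})$. For a finite word $w$, write $w\succ I_n$ if $w$ contains $2n-1$ consecutive symbols $1$. Let $\alpha$ be a placeholder symbol, to be replaced by $0$ or $1$. Put $x_1=1\alpha$, $\tilde x_1=11$, and inductively $x_n=x_{n-1}\tilde x_{n-1}x_{n-1}$, where $\tilde x_n$ is obtained from $x_n$ by changing one $\alpha$ to $1$ in such a way that $\tilde x_n\succ I_n$. The words $x_n,\tilde x_n$ have length $2\cdot 3^{n-1}$, $x_n$ contains exactly $p_n=\frac{3^{n-1}+1}{2}$ symbols $\alpha$, and $x_n$ is a prefix of $x_{n+1}$, so $x^+=\lim_n x_n\in\{1,\alpha\}^{\mathbb N}$ exists (indexed from $1$). Modify $x^+$ as follows: going from left to right, successively for $n=1,2,\dots$,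 choose $2^{p_n}$ occurrences of the block $x_n$ in the part of the sequence not yet treated, fill their $\alpha$'s with $0$'s and $1$'s so that all $2^{p_n}$ possible fillings of $x_n$ occur, and replace all other $\alpha$'s to the left of the end of the last chosen block by $1$. The resulting sequence in $\{0,1\}^{\mathbb N}$ is again denoted $x^+$. Define $x^*\in\Sigma(2)$ by $x^*(k)=x^+(k)$ for $k\ge1$, $x^*(0)=0$, $x^*(k)=x^+(-k)$ for $k\le-1$. It satisfies: (1) for all $k\in\mathbb Z$, $n\ge1$, $x^*(k)x^*(k+1)\cdots x^*(k+4\cdot3^n)\succ I_n$; (2) for all $n\ge2$, $x^*$ contains at least $2^{p_n}$ distinct finite subwords of length $2\cdot3^{n-1}$. Let $X=\overline{\{T^nx^*:n\in\mathbb Z\}}$, a compact $T$-invariant set, and $T=T|_X$; its topological entropy $h(T)$ is positive. $(X,T)$ has a unique fixed point, the all-ones sequence, denoted $1$. Put $X_*=X\setminus\{1\}$ (locally compact). Suspension flows. A roof function is a positive continuous function $\gamma:X_*\to(0,+\infty)$. Let $X_*^\gamma$ be the quotient of $\{(x,u):x\in X_*,\ 0\le u\le\gamma(x)\}$ by $(x,\gamma(x))\sim(Tx,0)$, with the suspension flow determined by $\varphi^\gamma_t(x,u)=(x,u+t)$ for $-u\le t<\gamma(x)-u$. Let $X^\gamma=X_*^\gamma\cup\{\Delta\}$ be the one-point compactification, a compact metric space in which $(x_n,u_n)\to\Delta$ if and only if $x_n\to1$ in $X$. The flow $\Phi^\gamma$ on $X^\gamma$ extends $\varphi^\gamma$ by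 $\Phi^\gamma_t(\Delta)=\Delta$ for all $t$. *)

theory Defs
  imports "HOL-Analysis.Analysis"
begin

section \<open>Topological entropy\<close>

definition open_cover :: "'a topology \<Rightarrow> 'a set set \<Rightarrow> bool" where
  "open_cover Z \<U> \<longleftrightarrow> (\<forall>U\<in>\<U>. openin Z U) \<and> \<Union>\<U> = topspace Z"

definition cover_number :: "'a topology \<Rightarrow> 'a set set \<Rightarrow> nat" where
  "cover_number Z \<U> = (LEAST m. \<exists>\<V>. \<V> \<subseteq> \<U> \<and> finite \<V> \<and> card \<V> = m \<and> \<Union>\<V> = topspace Z)"

text \<open>The join of the covers \<open>\<U>, f\<^sup>-\<^sup>1\<U>, \<dots>, f\<^sup>-\<^sup>(\<^sup>n\<^sup>-\<^sup>1\<^sup>)\<U>\<close>.\<close>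

definition iterated_join :: "'a topology \<Rightarrow> ('a \<Rightarrow> 'a) \<Rightarrow> 'a set set \<Rightarrow> nat \<Rightarrow> 'a set set" where
  "iterated_join Z f \<U> n =
     {{z \<in> topspace Z. \<forall>i<n. (f ^^ i) z \<in> c i} | c. \<forall>i<n. c i \<in> \<U>}"

text \<open>Entropy of a continuous self-map of a compact space in the sense of Adler, Konheim and
  McAndrew; it agrees with Bowen's entropy for every metric inducing the topology.  By
  subadditivity the limit superior below is a limit.\<close>

definition cover_entropy :: "'a topology \<Rightarrow> ('a \<Rightarrow> 'a) \<Rightarrow> 'a set set \<Rightarrow> ereal" where
  "cover_entropy Z f \<U> =
     limsup (\<lambda>n. ereal (ln (real (cover_number Z (iterated_join Z f \<U> n))) / real n))"

definition topological_entropy :: "'a topology \<Rightarrow> ('a \<Rightarrow> 'a) \<Rightarrow> ereal" where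
  "topological_entropy Z f = (SUP \<U>\<in>{\<U>. open_cover Z \<U>}. cover_entropy Z f \<U>)"

section \<open>Flows\<close>

definition flow :: "'a topology \<Rightarrow> (real \<Rightarrow> 'a \<Rightarrow> 'a) \<Rightarrow> bool" where
  "flow Z \<Phi> \<longleftrightarrow>
     compact_space Z \<and> metrizable_space Z \<and>
     continuous_map (prod_topology Z euclideanreal) Z (\<lambda>(z, t). \<Phi> t z) \<and>
     (\<forall>z\<in>topspace Z. \<Phi> 0 z = z) \<and>
     (\<forall>s t. \<forall>z\<in>topspace Z. \<Phi> t (\<Phi> s z) = \<Phi> (t + s) z)"

definition flow_entropy :: "'a topology \<Rightarrow> (real \<Rightarrow> 'a \<Rightarrow> 'a) \<Rightarrow> ereal" where
  "flow_entropy Z \<Phi> = topological_entropy Z (\<Phi> 1)"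

section \<open>Ohno's subshift\<close>

text \<open>The symbol 1 is \<^const>\<open>True\<close> and 0 is \<^const>\<open>False\<close>.  In words with placeholders,
  \<open>\<alpha>\<close> is \<^const>\<open>None\<close>.\<close>

type_synonym bisequence = "int \<Rightarrow> bool"
type_synonym pword = "bool option list"

definition full_shift :: "bisequence topology" where
  "full_shift = product_topology (\<lambda>_. discrete_topology UNIV) UNIV"

definition shift :: "bisequence \<Rightarrow> bisequence" where
  "shift x = (\<lambda>i. x (i + 1))"

text \<open>\<open>w \<succ> I\<^sub>n\<close>: the word \<open>w\<close> contains \<open>2n - 1\<close> consecutive symbols 1.\<close>

definition has_ones :: "pword \<Rightarrow> nat \<Rightarrow> bool" where
  "has_ones w n \<longleftrightarrow> (\<exists>u v. w = u @ replicate (2 * n - 1) (Some True) @ v)"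

text \<open>\<open>x n\<close> and \<open>x' n\<close> are the words \<open>x\<^sub>n\<close> and \<open>\<tilde>x\<^sub>n\<close> for \<open>n \<ge> 1\<close>.  Which placeholder
  is changed in passing from \<open>x\<^sub>n\<close> to \<open>\<tilde>x\<^sub>n\<close> is a free choice at each step, hence a predicate.\<close>

definition ohno_words :: "(nat \<Rightarrow> pword) \<Rightarrow> (nat \<Rightarrow> pword) \<Rightarrow> bool" where
  "ohno_words x x' \<longleftrightarrow>
     x 1 = [Some True, None] \<and> x' 1 = [Some True, Some True] \<and>
     (\<forall>n\<ge>1. x (Suc n) = x n @ x' n @ x n) \<and>
     (\<forall>n\<ge>1. (\<exists>i<length (x n). x n ! i = None \<and> x' n = (x n)[i := Some True]) \<and>
             has_ones (x' n) n)"

text \<open>One-sided sequences are indexed from 1; their value at 0 is irrelevant.\<close>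

definition limit_word :: "(nat \<Rightarrow> pword) \<Rightarrow> (nat \<Rightarrow> bool option) \<Rightarrow> bool" where
  "limit_word x y \<longleftrightarrow> (\<forall>n\<ge>1. \<forall>k<length (x n). y (Suc k) = x n ! k)"

definition fillings :: "pword \<Rightarrow> bool list set" where
  "fillings w = {v. length v = length w \<and> (\<forall>i<length w. \<forall>a. w ! i = Some a \<longrightarrow> v ! i = a)}"

definition placeholders :: "nat \<Rightarrow> nat" where
  "placeholders n = (3 ^ (n - 1) + 1) div 2"

text \<open>The sequence \<open>z\<close> arises from \<open>y = lim x\<^sub>n\<close> by the successive modifications.  At step
  \<open>n\<close>, the set \<open>S n\<close> consists of the starting positions of the chosen occurrences of \<open>x\<^sub>n\<close>,
  all of which lie to the right of the part \<open>{1..E (n - 1)}\<close> treated before, and \<open>E n\<close> is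
  the end of the last chosen block.\<close>

definition ohno_filling ::
    "(nat \<Rightarrow> pword) \<Rightarrow> (nat \<Rightarrow> bool option) \<Rightarrow> (nat \<Rightarrow> bool) \<Rightarrow> bool" where
  "ohno_filling x y z \<longleftrightarrow>
     (\<forall>k\<ge>1. \<forall>a. y k = Some a \<longrightarrow> z k = a) \<and>
     (\<exists>S E. E 0 = 0 \<and>
        (\<forall>n\<ge>1.
           finite (S n) \<and> card (S n) = 2 ^ placeholders n \<and>
           (\<forall>s\<in>S n. E (n - 1) < s \<and> map y [s..<s + length (x n)] = x n) \<and>
           (\<lambda>s. map z [s..<s + length (x n)]) ` S n = fillings (x n) \<and>
           E n = Max ((\<lambda>s. s + length (x n) - 1) ` S n) \<and>
           (\<forall>k\<in>{E (n - 1)<..E n}.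
              y k = None \<and> k \<notin> (\<Union>s\<in>S n. {s..<s + length (x n)}) \<longrightarrow> z k = True)))"

definition two_sided :: "(nat \<Rightarrow> bool) \<Rightarrow> bisequence" where
  "two_sided z = (\<lambda>k. if k = 0 then False else z (nat \<bar>k\<bar>))"

text \<open>\<open>xs\<close> is a possible outcome \<open>x\<^sup>*\<close> of the construction.\<close>

definition ohno_point :: "bisequence \<Rightarrow> bool" where
  "ohno_point xs \<longleftrightarrow>
     (\<exists>x x' y z. ohno_words x x' \<and> limit_word x y \<and> ohno_filling x y z \<and> xs = two_sided z)"

text \<open>The family \<open>\<lambda>i. xs (i + n)\<close>, \<open>n \<in> \<int>\<close>, is the two-sided orbit of \<open>xs\<close>
  under \<^const>\<open>shift\<close>.\<close>

definition orbit_closure :: "bisequence \<Rightarrow> bisequence set" where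
  "orbit_closure xs = full_shift closure_of (range (\<lambda>n::int. \<lambda>i. xs (i + n)))"

section \<open>Suspension flows\<close>

text \<open>Throughout, \<open>X\<close> is a closed shift-invariant set of bisequences; the all-ones sequence
  is removed before suspending.\<close>

definition punctured :: "bisequence set \<Rightarrow> bisequence set" where
  "punctured X = X - {\<lambda>_. True}"

definition roof_function :: "bisequence set \<Rightarrow> (bisequence \<Rightarrow> real) \<Rightarrow> bool" where
  "roof_function X \<gamma> \<longleftrightarrow>
     continuous_map (subtopology full_shift (punctured X)) euclideanreal \<gamma> \<and>
     (\<forall>x\<in>punctured X. 0 < \<gamma> x)"

definition region :: "bisequence set \<Rightarrow> (bisequence \<Rightarrow> real) \<Rightarrow> (bisequence \<times> real) set" where
  "region X \<gamma> = {(x, u). x \<in> punctured X \<and> 0 \<le> u \<and> u \<le> \<gamma> x}"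

definition glue ::
    "bisequence set \<Rightarrow> (bisequence \<Rightarrow> real) \<Rightarrow> ((bisequence \<times> real) \<times> (bisequence \<times> real)) set" where
  "glue X \<gamma> = {((x, \<gamma> x), (shift x, 0)) | x. x \<in> punctured X}"

definition glue_equiv ::
    "bisequence set \<Rightarrow> (bisequence \<Rightarrow> real) \<Rightarrow> ((bisequence \<times> real) \<times> (bisequence \<times> real)) set" where
  "glue_equiv X \<gamma> = (glue X \<gamma> \<union> (glue X \<gamma>)\<inverse>)\<^sup>* \<inter> (region X \<gamma> \<times> region X \<gamma>)"

definition quotient_topology :: "'a topology \<Rightarrow> ('a \<times> 'a) set \<Rightarrow> 'a set topology" where
  "quotient_topology Z R = topology (\<lambda>\<U>. \<U> \<subseteq> topspace Z // R \<and> openin Z (\<Union>\<U>))"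

definition suspension ::
    "bisequence set \<Rightarrow> (bisequence \<Rightarrow> real) \<Rightarrow> (bisequence \<times> real) set topology" where
  "suspension X \<gamma> =
     quotient_topology (subtopology (prod_topology full_shift euclideanreal) (region X \<gamma>))
       (glue_equiv X \<gamma>)"

text \<open>In the one-point compactification \<^const>\<open>None\<close> is the added point \<open>\<Delta>\<close>.\<close>

definition compact_suspension ::
    "bisequence set \<Rightarrow> (bisequence \<Rightarrow> real) \<Rightarrow> (bisequence \<times> real) set option topology" where
  "compact_suspension X \<gamma> = Alexandroff_compactification (suspension X \<gamma>)"

definition spoint ::
    "bisequence set \<Rightarrow> (bisequence \<Rightarrow> real) \<Rightarrow> bisequence \<times> real \<Rightarrow> (bisequence \<times> real) set option" where
  "spoint X \<gamma> p = Some (glue_equiv X \<gamma> `` {p})"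

text \<open>These conditions determine \<open>\<Phi> t\<close> on the whole space: the flow law propagates the local
  formula along orbits, and by continuity no orbit other than \<open>\<Delta>\<close> reaches \<open>\<Delta>\<close> in finite time.
  (If the sums of \<open>\<gamma>\<close> along some half-orbit converge, no such \<open>\<Phi>\<close> exists.)\<close>

definition suspension_flow ::
    "bisequence set \<Rightarrow> (bisequence \<Rightarrow> real) \<Rightarrow>
     (real \<Rightarrow> (bisequence \<times> real) set option \<Rightarrow> (bisequence \<times> real) set option) \<Rightarrow> bool" where
  "suspension_flow X \<gamma> \<Phi> \<longleftrightarrow>
     flow (compact_suspension X \<gamma>) \<Phi> \<and>
     (\<forall>(x, u)\<in>region X \<gamma>. \<forall>t. - u \<le> t \<and> t < \<gamma> x - u \<longrightarrow>
        \<Phi> t (spoint X \<gamma> (x, u)) = spoint X \<gamma> (x, u + t)) \<and>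
     (\<forall>t. \<Phi> t None = None)"

section \<open>Quotient topologies\<close>

lemma openin_quotient_topology:
  assumes "equiv (topspace Z) R"
  shows "openin (quotient_topology Z R) \<U> \<longleftrightarrow> \<U> \<subseteq> topspace Z // R \<and> openin Z (\<Union>\<U>)"
proof -
  have disj: "A = B" if "A \<in> topspace Z // R" "B \<in> topspace Z // R" "p \<in> A" "p \<in> B" for A B p
    using quotient_disj[OF assms that(1,2)] that(3,4) by blast
  have "istopology (\<lambda>\<U>. \<U> \<subseteq> topspace Z // R \<and> openin Z (\<Union>\<U>))"
    unfolding istopology_def
  proof (intro conjI allI impI)
    fix \<U> \<V>
    assume U: "\<U> \<subseteq> topspace Z // R \<and> openin Z (\<Union>\<U>)" and V: "\<V> \<subseteq> topspace Z // R \<and> openin Z (\<Union>\<V>)"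
    have "\<Union>(\<U> \<inter> \<V>) = \<Union>\<U> \<inter> \<Union>\<V>"
    proof (intro equalityI subsetI)
      fix p assume "p \<in> \<Union>\<U> \<inter> \<Union>\<V>"
      then obtain A B where AB: "A \<in> \<U>" "B \<in> \<V>" "p \<in> A" "p \<in> B" by blast
      with disj[of A B p] U V have "A = B" by blast
      with AB show "p \<in> \<Union>(\<U> \<inter> \<V>)" by blast
    qed blast
    with U V show "openin Z (\<Union>(\<U> \<inter> \<V>))" by (simp add: openin_Int)
    show "\<U> \<inter> \<V> \<subseteq> topspace Z // R" using U by blast
  next
    fix K assume K: "\<forall>\<U>\<in>K. \<U> \<subseteq> topspace Z // R \<and> openin Z (\<Union>\<U>)"
    then show "\<Union>K \<subseteq> topspace Z // R" by blast
    have "\<Union>(\<Union>K) = (\<Union>\<U>\<in>K. \<Union>\<U>)" by blast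
    moreover have "openin Z (\<Union>\<U>\<in>K. \<Union>\<U>)" by (intro openin_Union) (use K in blast)
    ultimately show "openin Z (\<Union>(\<Union>K))" by simp
  qed
  then show ?thesis
    unfolding quotient_topology_def by (simp add: topology_inverse')
qed

lemma quotient_map_quotient_topology:
  assumes "equiv (topspace Z) R"
  shows "quotient_map Z (quotient_topology Z R) (\<lambda>p. R `` {p})"
proof -
  have top: "topspace (quotient_topology Z R) = topspace Z // R"
  proof (rule subset_antisym)
    show "topspace (quotient_topology Z R) \<subseteq> topspace Z // R"
      using openin_quotient_topology[OF assms] openin_topspace by blast
    have "openin (quotient_topology Z R) (topspace Z // R)"
      by (simp add: openin_quotient_topology[OF assms] Union_quotient[OF assms])
    then show "topspace Z // R \<subseteq> topspace (quotient_topology Z R)"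
      by (rule openin_subset)
  qed
  have pre: "{p \<in> topspace Z. R `` {p} \<in> \<U>} = \<Union>\<U>" if U: "\<U> \<subseteq> topspace Z // R" for \<U>
  proof (intro equalityI subsetI)
    fix p assume "p \<in> {p \<in> topspace Z. R `` {p} \<in> \<U>}"
    then show "p \<in> \<Union>\<U>" using equiv_class_self[OF assms] by blast
  next
    fix p assume "p \<in> \<Union>\<U>"
    then obtain A where A: "A \<in> \<U>" "p \<in> A" by blast
    with U have AQ: "A \<in> topspace Z // R" by blast
    then have pZ: "p \<in> topspace Z" using A Union_quotient[OF assms] by blast
    have "R `` {p} = A"
      using AQ A(2) by (metis assms equiv_class_eq_iff Image_singleton_iff quotientE)
    with A pZ show "p \<in> {p \<in> topspace Z. R `` {p} \<in> \<U>}" by simp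
  qed
  show ?thesis
    unfolding quotient_map_def top
    by (auto simp: pre openin_quotient_topology[OF assms] quotient_def)
qed

lemma equiv_glue_equiv: "equiv (region X \<gamma>) (glue_equiv X \<gamma>)"
proof (rule equivI)
  show "glue_equiv X \<gamma> \<subseteq> region X \<gamma> \<times> region X \<gamma>" by (auto simp: glue_equiv_def)
  show "refl_on (region X \<gamma>) (glue_equiv X \<gamma>)" by (auto simp: refl_on_def glue_equiv_def)
  have "sym ((glue X \<gamma> \<union> (glue X \<gamma>)\<inverse>)\<^sup>*)" by (intro sym_rtrancl sym_Un_converse)
  then show "sym (glue_equiv X \<gamma>)"
    unfolding glue_equiv_def by (auto simp: sym_def)
  show "trans (glue_equiv X \<gamma>)"
    unfolding glue_equiv_def by (auto intro!: transI elim: rtrancl_trans)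
qed

section \<open>The choices in Ohno's construction can be made\<close>

definition expand :: "pword \<Rightarrow> pword" where
  "expand w = concat (map (\<lambda>a. [Some True, a]) w)"

lemma expand_append [simp]: "expand (u @ v) = expand u @ expand v"
  by (simp add: expand_def)

lemma expand_simps [simp]: "expand [] = []" "expand (a # w) = Some True # a # expand w"
  by (simp_all add: expand_def)

lemma length_expand [simp]: "length (expand w) = 2 * length w"
  by (induction w) auto

lemma count_expand [simp]: "count_list (expand w) None = count_list w None"
  by (induction w) auto

lemma expand_replicate: "expand (replicate n (Some True)) = replicate (2 * n) (Some True)"
  by (induction n) auto

lemma expand_update:
  "i < length w \<Longrightarrow> expand (w[i := a]) = (expand w)[2 * i + 1 := a]"
  by (induction w arbitrary: i) (auto split: nat.split)

lemma expand_nth: "i < length w \<Longrightarrow> expand w ! (2 * i + 1) = w ! i"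
  by (induction w arbitrary: i) (auto simp: nth_Cons split: nat.split)

lemma replicate_if_all: "\<forall>x\<in>set w. x = a \<Longrightarrow> w = replicate (length w) a"
  by (simp add: replicate_length_same)

lemma lengthen_run:
  assumes "set w \<subseteq> {Some True, None}" "None \<in> set w"
    and "w = u @ replicate n (Some True) @ v"
  shows "\<exists>i<length w. w ! i = None \<and>
           (\<exists>u' v'. w[i := Some True] = u' @ replicate (Suc n) (Some True) @ v')"
proof -
  have "None \<in> set u \<or> None \<in> set v" using assms by auto
  then show ?thesis
  proof
    assume "None \<in> set v"
    then obtain v1 v2 where v: "v = v1 @ None # v2" "None \<notin> set v1"
      by (meson split_list_first)
    have "\<forall>x\<in>set v1. x = Some True" using assms(1,3) v by auto
    then have v1: "v1 = replicate (length v1) (Some True)" by (rule replicate_if_all)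
    let ?i = "length u + n + length v1"
    have w: "w = (u @ replicate n (Some True) @ v1) @ None # v2" using assms(3) v by simp
    have "w[?i := Some True] = (u @ replicate n (Some True) @ v1) @ Some True # v2"
      unfolding w by (simp add: list_update_append)
    also have "\<dots> = u @ replicate (Suc n) (Some True) @ (replicate (length v1) (Some True) @ v2)"
      by (subst v1) (simp add: replicate_append_same replicate_app_Cons_same flip: replicate_add)
    finally have e: "w[?i := Some True] = u @ replicate (Suc n) (Some True) @ (replicate (length v1) (Some True) @ v2)" .
    have n: "w ! ?i = None" "?i < length w" unfolding w by (simp_all add: nth_append)
    show ?thesis
      by (rule exI[of _ ?i]) (use n e in blast)
  next
    assume "None \<in> set u"
    then obtain v1 v2 where v: "u = v1 @ None # v2" "None \<notin> set v2"
      by (meson split_list_last)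
    have "\<forall>x\<in>set v2. x = Some True" using assms(1,3) v by auto
    then have v1: "v2 = replicate (length v2) (Some True)" by (rule replicate_if_all)
    let ?i = "length v1"
    have w: "w = v1 @ None # v2 @ replicate n (Some True) @ v" using assms(3) v by simp
    have "w[?i := Some True] = v1 @ Some True # v2 @ replicate n (Some True) @ v"
      unfolding w by (simp add: list_update_append)
    also have "\<dots> = v1 @ replicate (Suc n) (Some True) @ (replicate (length v2) (Some True) @ v)"
      by (subst v1) (simp add: replicate_append_same replicate_app_Cons_same add.commute flip: replicate_add append_assoc)
    finally have e: "w[?i := Some True] = v1 @ replicate (Suc n) (Some True) @ (replicate (length v2) (Some True) @ v)" .
    have n: "w ! ?i = None" "?i < length w" unfolding w by (simp_all add: nth_append)
    show ?thesis
      by (rule exI[of _ ?i]) (use n e in blast)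
  qed
qed

lemma count_update:
  assumes "i < length w" "w ! i = None"
  shows "Suc (count_list (w[i := Some True]) None) = count_list w None"
proof -
  have "w = take i w @ None # drop (Suc i) w" using assms by (metis id_take_nth_drop)
  moreover have "w[i := Some True] = take i w @ Some True # drop (Suc i) w"
    using assms by (simp add: upd_conv_take_nth_drop)
  ultimately show ?thesis
    by (metis add_Suc_right count_list.simps(2) count_list_append option.distinct(1) add.right_neutral Suc_eq_plus1)
qed

lemma ex_halfwords:
  obtains a a' :: "nat \<Rightarrow> pword" where
    "a 0 = [None]" "\<And>n. a (Suc n) = a n @ a' n @ a n"
    "\<And>n. \<exists>i<length (a n). a n ! i = None \<and> a' n = (a n)[i := Some True]"
    "\<And>n. \<exists>u v. a' n = u @ replicate (Suc n) (Some True) @ v"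
    "\<And>n. length (a n) = 3 ^ n" "\<And>n. count_list (a n) None = (3 ^ n + 1) div 2"
proof -
  define P where "P n p \<longleftrightarrow> (case p of (w, w') \<Rightarrow>
      set w \<subseteq> {Some True, None} \<and> length w = 3 ^ n \<and> 2 * count_list w None = 3 ^ n + 1 \<and>
      (n = 0 \<longrightarrow> w = [None]) \<and>
      (\<exists>i<length w. w ! i = None \<and> w' = w[i := Some True]) \<and>
      (\<exists>u v. w' = u @ replicate (Suc n) (Some True) @ v))" for n and p :: "pword \<times> pword"
  define Q where "Q n p q \<longleftrightarrow> fst q = fst p @ snd p @ fst p" for n :: nat and p q :: "pword \<times> pword"
  have "\<exists>f. \<forall>n. P n (f n) \<and> Q n (f n) (f (Suc n))"
  proof (rule dependent_nat_choice)
    have "P 0 ([None], [Some True])" unfolding P_def by (auto intro!: exI[of _ "[]"])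
    then show "\<exists>p. P 0 p" by blast
  next
    fix p n assume "P n p"
    obtain w w' where p: "p = (w, w')" by force
    with \<open>P n p\<close> obtain i u v where *: "set w \<subseteq> {Some True, None}" "length w = 3 ^ n"
      "2 * count_list w None = 3 ^ n + 1" "i < length w" "w ! i = None" "w' = w[i := Some True]"
      "w' = u @ replicate (Suc n) (Some True) @ v"
      unfolding P_def by auto
    let ?x = "w @ w' @ w"
    have sw': "set w' \<subseteq> {Some True, None}"
      unfolding *(6) using *(1) set_update_subset_insert[of w i "Some True"] by blast
    have None: "None \<in> set w" using *(4,5) nth_mem by metis
    have "?x = (w @ u) @ replicate (Suc n) (Some True) @ (v @ w)" using *(7) by simp
    from lengthen_run[OF _ _ this] obtain j u' v' where
      j: "j < length ?x" "?x ! j = None" "?x[j := Some True] = u' @ replicate (Suc (Suc n)) (Some True) @ v'"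
      using *(1) sw' None by (metis (no_types, lifting) Un_iff le_sup_iff set_append)
    have c: "Suc (count_list w' None) = count_list w None" using count_update *(4,5,6) by metis
    have l: "length ?x = 3 ^ Suc n" using *(2,6) by simp
    have c': "2 * count_list ?x None = 3 ^ Suc n + 1" using c *(3) by simp
    have "P (Suc n) (?x, ?x[j := Some True])"
      unfolding P_def prod.case
    proof (intro conjI)
      show "set ?x \<subseteq> {Some True, None}" using *(1) sw' by simp
      show "\<exists>i<length ?x. ?x ! i = None \<and> ?x[j := Some True] = ?x[i := Some True]"
        using j by blast
      show "\<exists>u v. ?x[j := Some True] = u @ replicate (Suc (Suc n)) (Some True) @ v"
        using j by blast
    qed (use l c' in simp_all)
    then show "\<exists>q. P (Suc n) q \<and> Q n p q" unfolding Q_def p by auto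
  qed
  then obtain f where f: "\<And>n. P n (f n)" "\<And>n. Q n (f n) (f (Suc n))" by blast
  show ?thesis
  proof (rule that[of "\<lambda>n. fst (f n)" "\<lambda>n. snd (f n)"])
    show "count_list (fst (f n)) None = (3 ^ n + 1) div 2" for n
      using f(1)[of n] unfolding P_def by (auto split: prod.splits)
  qed (use f(1)[unfolded P_def case_prod_unfold] f(2)[unfolded Q_def] in blast)+
qed

lemma fillings_Cons:
  "fillings (Some a # w) = (#) a ` fillings w"
  "fillings (None # w) = (#) True ` fillings w \<union> (#) False ` fillings w"
  by (auto simp: fillings_def image_iff length_Suc_conv nth_Cons less_Suc_eq_0_disj split: nat.splits)

lemma card_fillings: "finite (fillings w) \<and> card (fillings w) = 2 ^ count_list w None"
proof (induction w)
  case Nil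
  have "fillings [] = {[]}" by (auto simp: fillings_def)
  then show ?case by simp
next
  case (Cons b w)
  have "card ((#) True ` fillings w \<union> (#) False ` fillings w) =
    card ((#) True ` fillings w) + card ((#) False ` fillings w)"
    using Cons by (intro card_Un_disjoint) auto
  with Cons show ?case by (cases b) (auto simp: fillings_Cons card_image)
qed


theorem ex_ohno_point: "\<exists>xs. ohno_point xs"
proof -
  obtain a a' :: "nat \<Rightarrow> pword" where
    a0: "a 0 = [None]" and aS: "\<And>n. a (Suc n) = a n @ a' n @ a n"
    and a': "\<And>n. \<exists>i<length (a n). a n ! i = None \<and> a' n = (a n)[i := Some True]"
    and run: "\<And>n. \<exists>u v. a' n = u @ replicate (Suc n) (Some True) @ v"
    and la: "\<And>n. length (a n) = 3 ^ n" and ca: "\<And>n. count_list (a n) None = (3 ^ n + 1) div 2"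
    by (rule ex_halfwords) (rule that, assumption+)
  define x where "x n = expand (a (n - 1))" for n
  define x' where "x' n = expand (a' (n - 1))" for n
  have la': "length (a' n) = length (a n)" for n using a'[of n] by auto
  define L :: "nat \<Rightarrow> nat" where "L n = 2 * 3 ^ (n - 1)" for n
  have lx: "length (x n) = L n" for n by (simp add: x_def L_def la)
  have xS: "x (Suc n) = x n @ x' n @ x n" if "n \<ge> 1" for n
    using that aS[of "n - 1"] by (simp add: x_def x'_def)
  have words: "ohno_words x x'"
    unfolding ohno_words_def
  proof (intro conjI allI impI)
    show "x 1 = [Some True, None]" by (simp add: x_def a0)
    have "a' 0 = [Some True]" using a'[of 0] a0 by auto
    then show "x' 1 = [Some True, Some True]" by (simp add: x'_def)
  next
    fix n :: nat assume n: "n \<ge> 1"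
    show "x (Suc n) = x n @ x' n @ x n" by (rule xS[OF n])
    obtain i where i: "i < length (a (n - 1))" "a (n - 1) ! i = None"
      "a' (n - 1) = (a (n - 1))[i := Some True]" using a' by blast
    show "\<exists>i<length (x n). x n ! i = None \<and> x' n = (x n)[i := Some True]"
      by (rule exI[of _ "2 * i + 1"])
         (use i expand_nth[OF i(1)] expand_update[OF i(1)] in \<open>simp add: x_def x'_def\<close>)
    obtain u v where "a' (n - 1) = u @ replicate n (Some True) @ v"
      using run[of "n - 1"] n by auto
    then have "x' n = expand u @ replicate (2 * n) (Some True) @ expand v"
      by (simp add: x'_def expand_replicate)
    also have "replicate (2 * n) (Some True) = replicate (2 * n - 1) (Some True) @ [Some True]"
      using n by (cases n) (simp_all add: replicate_append_same)
    finally show "has_ones (x' n) n" unfolding has_ones_def by auto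
  qed
  have Lpos: "L n > 0" for n by (simp add: L_def)
  have L3: "L (Suc n) = 3 * L n" if "n \<ge> 1" for n
    using that by (cases n) (simp_all add: L_def)
  have Lgt: "n \<le> L n" for n
  proof -
    have "k < 3 ^ k" for k :: nat by (induction k) auto
    then have "n - 1 < 3 ^ (n - 1)" .
    then show ?thesis unfolding L_def by linarith
  qed
  have Lmono: "L m \<le> L n" if "m \<le> n" for m n
    using that by (simp add: L_def power_increasing)
  have pre: "x m ! k = x n ! k" if "1 \<le> n" "n \<le> m" "k < L n" for m n k
    using that(2) that(1,3)
  proof (induction m rule: dec_induct)
    case (step m)
    have "k < L m" using step.prems Lmono[OF step.hyps(1)] by linarith
    then show ?case using step xS[of m] lx[of m] by (simp add: nth_append)
  qed simp
  define y where "y k = x k ! (k - 1)" for k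
  have yx: "y (Suc k) = x n ! k" if "n \<ge> 1" "k < L n" for k n
  proof (cases "n \<le> Suc k")
    case True
    then show ?thesis using pre[of n "Suc k" k] that by (simp add: y_def)
  next
    case False
    have "k < L (Suc k)" using Lgt[of "Suc k"] by linarith
    then show ?thesis using pre[of "Suc k" n k] False by (simp add: y_def)
  qed
  have lim: "limit_word x y"
    unfolding limit_word_def using yx lx by simp
  define t where "t m = 1 + 2 * L m" for m
  have occ: "map y [t m..<t m + length (x n)] = x n" if "1 \<le> n" "n \<le> m" for n m
  proof (rule nth_equalityI)
    fix k assume k: "k < length (map y [t m..<t m + length (x n)])"
    then have kn: "k < L n" by (simp add: lx)
    then have km: "k < L m" using Lmono[OF that(2)] by linarith
    have m: "m \<ge> 1" using that by simp
    have "length (x' m) = L m" by (simp add: x'_def la' la L_def)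
    then have "x (Suc m) ! (2 * L m + k) = x m ! k"
      using xS[OF m] lx[of m] km by (simp add: nth_append)
    moreover have "y (Suc (2 * L m + k)) = x (Suc m) ! (2 * L m + k)"
      by (rule yx) (use km L3[OF m] in auto)
    ultimately have "y (t m + k) = x n ! k"
      using pre[OF that kn] by (simp add: t_def)
    then show "map y [t m..<t m + length (x n)] ! k = x n ! k" using k by simp
  qed simp
  define p :: "nat \<Rightarrow> nat" where "p n = placeholders n" for n
  define M :: "nat \<Rightarrow> nat" where "M n = (\<Sum>i=1..n. 2 ^ p i) + n" for n
  have MS: "M n = M (n - 1) + 2 ^ p n + 1" if "n \<ge> 1" for n
    using that by (cases n) (simp_all add: M_def)
  have Mmono: "M m \<le> M n" if "m \<le> n" for m n
    unfolding M_def by (intro add_mono sum_mono2) (use that in auto)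
  have Mge: "n \<le> M n" for n by (simp add: M_def)
  define stage where "stage n = {M (n - 1)<..<M n}" for n
  have cs: "card (stage n) = 2 ^ p n" if "n \<ge> 1" for n
    unfolding stage_def using MS[OF that] by simp
  have sfin: "finite (stage n)" for n by (simp add: stage_def)
  have sne: "stage n \<noteq> {}" if "n \<ge> 1" for n
  proof
    assume "stage n = {}"
    with cs[OF that] show False by simp
  qed
  have sm: "n \<le> m" if "m \<in> stage n" for n m
    using that Mge[of "n - 1"] by (auto simp: stage_def)
  have "\<exists>g. bij_betw g (stage n) (fillings (x n))" if n: "n \<ge> 1" for n
  proof (rule finite_same_card_bij)
    show "finite (stage n)" by (simp add: stage_def)
    show "finite (fillings (x n))" using card_fillings by blast
    show "card (stage n) = card (fillings (x n))"
      using cs[OF n] card_fillings[of "x n"] ca[of "n - 1"]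
      by (simp add: x_def p_def placeholders_def)
  qed
  then obtain g where g: "\<And>n. n \<ge> 1 \<Longrightarrow> bij_betw (g n) (stage n) (fillings (x n))" by metis
  define C where "C n m k \<longleftrightarrow> n \<ge> 1 \<and> m \<in> stage n \<and> t m \<le> k \<and> k < t m + L n" for n m k
  have stage_disj: "n1 = n2" if "n1 \<ge> 1" "n2 \<ge> 1" "m \<in> stage n1" "m \<in> stage n2" for n1 n2 m
  proof (rule linorder_cases[of n1 n2])
    assume "n1 < n2" then have "M n1 \<le> M (n2 - 1)" by (intro Mmono) simp
    then show ?thesis using that by (auto simp: stage_def)
  next
    assume "n2 < n1" then have "M n2 \<le> M (n1 - 1)" by (intro Mmono) simp
    then show ?thesis using that by (auto simp: stage_def)
  qed
  have tgap: "t m1 + L n < t m2" if "n \<ge> 1" "n \<le> m1" "m1 < m2" for n m1 m2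
  proof -
    have "L n \<le> L m1" "3 * L m1 \<le> L m2"
      using Lmono[of n m1] Lmono[of "Suc m1" m2] L3[of m1] that by simp_all
    then show ?thesis using Lpos[of m1] unfolding t_def by linarith
  qed
  have uniq: "n1 = n2 \<and> m1 = m2" if c: "C n1 m1 k" "C n2 m2 k" for n1 m1 n2 m2 k
  proof -
    have "m1 = m2"
    proof (rule linorder_cases[of m1 m2])
      assume "m1 < m2" then show ?thesis using tgap[of n1 m1 m2] c sm by (force simp: C_def)
    next
      assume "m2 < m1" then show ?thesis using tgap[of n2 m2 m1] c sm by (force simp: C_def)
    qed
    with c stage_disj[of n1 n2 m1] show ?thesis by (auto simp: C_def)
  qed
  define z where "z k = (case y k of Some b \<Rightarrow> b | None \<Rightarrow>
     (\<forall>n m. C n m k \<longrightarrow> g n m ! (k - t m)))" for k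
  have zblock: "map z [t m..<t m + length (x n)] = g n m" if n: "n \<ge> 1" and m: "m \<in> stage n" for n m
  proof (rule nth_equalityI)
    have gf: "g n m \<in> fillings (x n)" using g[OF n] m by (auto simp: bij_betw_def)
    then show len: "length (map z [t m..<t m + length (x n)]) = length (g n m)"
      by (simp add: fillings_def)
    fix k assume "k < length (map z [t m..<t m + length (x n)])"
    then have k: "k < L n" by (simp add: lx)
    have yk: "y (t m + k) = x n ! k"
      using arg_cong[OF occ[OF n sm[OF m]], of "\<lambda>l. l ! k"] k by (simp add: lx)
    have C: "C n m (t m + k)" using n m k by (simp add: C_def)
    have "z (t m + k) = g n m ! k"
    proof (cases "x n ! k")
      case None
      have "g n' m' ! (t m + k - t m') = g n m ! k" if "C n' m' (t m + k)" for n' m'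
        using uniq[OF C that] by simp
      with C have "(\<forall>n' m'. C n' m' (t m + k) \<longrightarrow> g n' m' ! (t m + k - t m')) = g n m ! k"
        by blast
      with None yk show ?thesis by (simp only: z_def option.case)
    next
      case (Some b)
      then show ?thesis using yk gf k by (auto simp: z_def fillings_def lx)
    qed
    then show "map z [t m..<t m + length (x n)] ! k = g n m ! k" using k by (simp add: lx)
  qed
  define S where "S n = t ` stage n" for n
  define E where "E n = (if n = 0 then 0 else Max ((\<lambda>s. s + length (x n) - 1) ` S n))" for n
  have tinj: "inj_on t (stage n)" if "n \<ge> 1" for n
  proof (rule inj_onI)
    fix m1 m2 assume "t m1 = t m2" "m1 \<in> stage n" "m2 \<in> stage n"
    then have "m1 - 1 = m2 - 1" "n \<le> m1" "n \<le> m2" using sm unfolding t_def L_def by simp_all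
    with that show "m1 = m2" by linarith
  qed
  have Eup: "k < t m + L n \<Longrightarrow> k \<le> E n" if "n \<ge> 1" "m \<in> stage n" for n m k
  proof -
    have "t m + length (x n) - 1 \<le> E n"
      unfolding E_def using that by (auto intro!: Max_ge simp: S_def stage_def)
    then show "k < t m + L n \<Longrightarrow> k \<le> E n" by (simp add: lx)
  qed
  have Elow: "E n1 < t m" if "n1 < n2" "m \<in> stage n2" for n1 n2 m
  proof (cases "n1 = 0")
    case True
    then show ?thesis by (simp add: E_def t_def)
  next
    case False
    have "(\<lambda>s. s + length (x n1) - 1) ` S n1 \<noteq> {}" "finite ((\<lambda>s. s + length (x n1) - 1) ` S n1)"
      using sne[of n1] sfin[of n1] False by (simp_all add: S_def)
    then have "E n1 \<in> (\<lambda>s. s + length (x n1) - 1) ` S n1"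
      using Max_in False by (simp add: E_def)
    then obtain m1 where m1: "m1 \<in> stage n1" "E n1 = t m1 + L n1 - 1" by (auto simp: S_def lx)
    have "M n1 \<le> M (n2 - 1)" using that by (intro Mmono) simp
    then have "m1 < m" using m1(1) that by (auto simp: stage_def)
    then show ?thesis using tgap[of n1 m1 m] sm[OF m1(1)] m1(2) False by linarith
  qed
  have "ohno_filling x y z"
    unfolding ohno_filling_def
  proof (intro conjI exI[of _ S] exI[of _ E] allI impI)
    fix k b assume "y k = Some b" then show "z k = b" by (simp add: z_def)
  next
    show "E 0 = 0" by (simp add: E_def)
  next
    fix n :: nat assume n: "n \<ge> 1"
    show "finite (S n)" by (simp add: S_def stage_def)
    show "card (S n) = 2 ^ placeholders n"
      using cs[OF n] tinj[OF n] by (simp add: S_def card_image p_def)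
    show "\<forall>s\<in>S n. E (n - 1) < s \<and> map y [s..<s + length (x n)] = x n"
      using occ[OF n] sm Elow[of "n - 1" n] n by (auto simp: S_def)
    have "(\<lambda>s. map z [s..<s + length (x n)]) ` S n = g n ` stage n"
      unfolding S_def image_image using zblock[OF n] by auto
    then show "(\<lambda>s. map z [s..<s + length (x n)]) ` S n = fillings (x n)"
      using g[OF n] by (simp add: bij_betw_def)
    show "E n = Max ((\<lambda>s. s + length (x n) - 1) ` S n)" using n by (simp add: E_def)
    show "\<forall>k\<in>{E (n - 1)<..E n}. y k = None \<and> k \<notin> (\<Union>s\<in>S n. {s..<s + length (x n)}) \<longrightarrow> z k = True"
    proof (intro ballI impI)
      fix k assume k: "k \<in> {E (n - 1)<..E n}" and
        h: "y k = None \<and> k \<notin> (\<Union>s\<in>S n. {s..<s + length (x n)})"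
      have "\<not> C n' m k" for n' m
      proof
        assume c: "C n' m k"
        then have n': "n' \<ge> 1" and m: "m \<in> stage n'" and b: "t m \<le> k" "k < t m + L n'"
          by (auto simp: C_def)
        consider "n' < n" | "n' = n" | "n' > n" by linarith
        then show False
        proof cases
          case 1
          have "k \<le> E n'" using Eup[OF n' m] b by blast
          also have "E n' \<le> E (n - 1)"
          proof (cases "n' = n - 1")
            case False
            with 1 have "n' < n - 1" by simp
            moreover have "stage (n - 1) \<noteq> {}" using sne[of "n - 1"] \<open>n' < n - 1\<close> by simp
            then obtain m0 where m0: "m0 \<in> stage (n - 1)" by blast
            ultimately have "E n' < t m0" using Elow by blast
            moreover have "t m0 \<le> E (n - 1)"
              using Eup[of "n - 1" m0 "t m0"] m0 Lpos \<open>n' < n - 1\<close> by simp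
            ultimately show ?thesis by simp
          qed simp
          finally show False using k by simp
        next
          case 2
          then show False using m b h by (auto simp: S_def lx)
        next
          case 3
          then show False using Elow[OF 3 m] k b by simp
        qed
      qed
      then show "z k = True" using h by (simp add: z_def)
    qed
  qed
  with words lim show ?thesis unfolding ohno_point_def by blast
qed

end

theory Submission
  imports Defs
begin

text \<open>A constant roof suffices.  Write \<open>h\<close> for the exponential growth rate of the number of
  words of \<open>X\<close>.  For the roof \<open>c\<close>, the time-\<open>c\<close> map is \<open>T\<close> acting on the first coordinate, so its
  entropy is \<open>h\<close>, whatever \<open>c\<close> is; hence the time-1 map has entropy \<open>h / c\<close>, and \<open>c = h / b\<close>
  gives \<open>b\<close>.  This needs \<open>0 < h < \<infinity>\<close>: the fillings of \<open>x\<^sub>n\<close> give at least \<open>2\<^sup>m\<close> words of length \<open>l\<close>,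
  where \<open>l\<close> is the length of \<open>x\<^sub>n\<close> and \<open>m \<ge> l / 4\<close> its number of placeholders, and
  there are at most \<open>2\<^sup>n\<close> words of length \<open>n\<close>.\<close>

section \<open>Translations of bisequences and rows of bumps\<close>

text \<open>The obstacle is topological: the phase space is a quotient with a point added, and both
  its metrizability and the joint continuity of a flow on it are awkward to obtain from gluing. They
  are read off an embedding into functions on the line. A point goes to the row of bumps marking the
  zeros of its sequence, \<Delta> goes to the zero function, and the flow becomes translation of the
  argument. All these functions share one Lipschitz constant, which gives joint continuity and lets
  rational arguments suffice.

  The time-\<open>c\<close> map is the shift only on base points. Every other point is a base point
  flowed for a time in \<open>{0..c}\<close>, and this compact fibre multiplies cover numbers by a
  bounded factor, invisible to the exponential rate.

  Since entropy is a supremum of limits superior over covers, everything is an inequality between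
  cover numbers. The linear dependence on time comes from one inequality between the entropies of
  two time maps, used in both directions.\<close>

definition translate :: "int \<Rightarrow> bisequence \<Rightarrow> bisequence" where
  "translate k x = (\<lambda>i. x (i + k))"

lemma shift_eq_translate: "shift = translate 1"
  by (simp add: shift_def translate_def fun_eq_iff)

lemma translate_translate: "translate j (translate k x) = translate (j + k) x"
  by (simp add: translate_def add.assoc)

lemma translate_0 [simp]: "translate 0 x = x"
  by (simp add: translate_def)

lemma translate_ones_iff [simp]: "translate k x = (\<lambda>_. True) \<longleftrightarrow> x = (\<lambda>_. True)"
  by (auto simp: translate_def fun_eq_iff) (metis diff_add_cancel)

lemma topspace_full_shift [simp]: "topspace full_shift = UNIV"
  by (simp add: full_shift_def)

lemma compact_space_full_shift: "compact_space full_shift"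
  by (simp add: full_shift_def compact_space_product_topology compact_space_discrete_topology)

lemma continuous_map_coordinate: "continuous_map full_shift (discrete_topology UNIV) (\<lambda>x. x i)"
  unfolding full_shift_def by (rule continuous_map_product_projection) simp

lemma continuous_map_translate: "continuous_map full_shift full_shift (translate k)"
proof -
  have "continuous_map full_shift (discrete_topology UNIV) (\<lambda>x. translate k x i)" for i
    unfolding translate_def by (rule continuous_map_coordinate)
  then show ?thesis
    by (subst (2) full_shift_def) (simp add: continuous_map_componentwise_UNIV)
qed

lemma translate_orbit_closure:
  assumes "x \<in> orbit_closure xs"
  shows "translate k x \<in> orbit_closure xs"
proof -
  let ?O = "range (\<lambda>n::int. \<lambda>i. xs (i + n))"
  have "translate k ` ?O \<subseteq> ?O"
    by (auto simp: translate_def add.assoc)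
  then have "full_shift closure_of (translate k ` ?O) \<subseteq> full_shift closure_of ?O"
    by (rule closure_of_mono)
  with continuous_map_image_closure_subset[OF continuous_map_translate, of k ?O] assms
  show ?thesis unfolding orbit_closure_def by blast
qed

lemma translate_mem_orbit_closure: "translate k xs \<in> orbit_closure xs"
proof -
  have "range (\<lambda>n::int. \<lambda>i. xs (i + n)) \<subseteq> orbit_closure xs"
    unfolding orbit_closure_def by (rule closure_of_subset) simp
  then show ?thesis by (auto simp: translate_def)
qed

text \<open>Tents of height 1/2 over the symbols 0. They vanish at the integers, so neighbouring
  pieces fit together with slopes at most 1, and the all-ones sequence gives the zero function, the
  value wanted at \<Delta>.\<close>

definition bump :: "bisequence \<Rightarrow> real \<Rightarrow> real" where
  "bump x t = (if x \<lfloor>t\<rfloor> then 0 else min (frac t) (1 - frac t))"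

lemma bump_ones [simp]: "bump (\<lambda>_. True) t = 0"
  by (simp add: bump_def)

lemma bump_add_int: "bump x (t + of_int k) = bump (translate k x) t"
  by (simp add: bump_def translate_def frac_def)

lemma bump_half [simp]: "bump x (of_int i + 1 / 2) = (if x i then 0 else 1 / 2)"
proof -
  have "\<lfloor>of_int i + 1 / 2 :: real\<rfloor> = i" by linarith
  then show ?thesis by (simp add: bump_def frac_def)
qed

lemma bump_eq_halfD: "bump x t = 1 / 2 \<Longrightarrow> frac t = 1 / 2"
  by (auto simp: bump_def min_def split: if_splits)

lemma bump_lipschitz: "\<bar>bump x s - bump x t\<bar> \<le> \<bar>s - t\<bar>"
proof (induction s t rule: linorder_wlog)
  case (le s t)
  have b: "0 \<le> bump x r" "bump x r \<le> of_int \<lfloor>r\<rfloor> + 1 - r" "bump x r \<le> r - of_int \<lfloor>r\<rfloor>" for r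
    unfolding bump_def frac_def by (auto simp: min_def) linarith+
  show ?case
  proof (cases "\<lfloor>s\<rfloor> = \<lfloor>t\<rfloor>")
    case True
    then show ?thesis unfolding bump_def frac_def by (auto simp: min_def)
  next
    case False
    \<comment> \<open>An integer now separates \<open>s\<close> and \<open>t\<close>. The two values
      are at most the distances to the end of the unit interval of \<open>s\<close> and to the start
      of that of \<open>t\<close>, and these distances add up to at most
      \<open>t - s\<close>.\<close>
    with le have "of_int \<lfloor>s\<rfloor> + 1 \<le> (of_int \<lfloor>t\<rfloor> :: real)"
      using floor_mono[OF le] by linarith
    with b[of s] b[of t] show ?thesis by linarith
  qed
qed (simp add: abs_minus_commute)

text \<open>The midpoints of the bumps locate the zeros of \<open>x\<close> modulo 1.\<close>

lemma bump_shift_eqD: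
  assumes eq: "\<And>t. bump x t = bump y (t + d)" and "x \<noteq> (\<lambda>_. True)"
  obtains k :: int where "d = of_int k" "x = translate k y"
proof -
  obtain i where i: "\<not> x i" using assms(2) by auto
  then have "frac (of_int i + 1 / 2 + d) = 1 / 2"
    using eq[of "of_int i + 1 / 2"] by (intro bump_eq_halfD[of y]) simp
  then obtain k :: int where k: "d = of_int k"
    by (intro that[of "\<lfloor>of_int i + 1 / 2 + d\<rfloor> - i"]) (simp add: frac_def)
  have "x j = translate k y j" for j
    using eq[of "of_int j + 1 / 2"] by (simp add: k bump_add_int split: if_splits)
  then show ?thesis using that k by blast
qed

lemma continuous_map_bump: "continuous_map full_shift euclideanreal (\<lambda>x. bump x t)"
proof -
  have "continuous_map (discrete_topology UNIV) euclideanreal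
      (\<lambda>a. if a then 0 else min (frac t) (1 - frac t))"
    by simp
  from continuous_map_compose[OF continuous_map_coordinate this] show ?thesis
    by (simp add: bump_def comp_def)
qed

text \<open>Continuity in each variable separately would not do; the Lipschitz bound in the second
  one is uniform in \<open>z\<close> and makes it joint. It serves the rows of bumps and later the
  profiles of the suspension.\<close>

lemma continuous_map_lipschitz_evaluation:
  fixes e :: "'a \<Rightarrow> real \<Rightarrow> real"
  assumes cont: "\<And>r. continuous_map Z euclideanreal (\<lambda>z. e z r)"
    and lip: "\<And>z r s. z \<in> topspace Z \<Longrightarrow> \<bar>e z r - e z s\<bar> \<le> L * \<bar>r - s\<bar>"
  shows "continuous_map (prod_topology Z euclideanreal) euclideanreal (\<lambda>(z, r). e z r)"
proof -
  have "openin (prod_topology Z euclideanreal)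
      {p \<in> topspace (prod_topology Z euclideanreal). (\<lambda>(z, r). e z r) p \<in> U}" if "open U" for U
  proof (subst openin_subopen, clarsimp)
    fix z r assume z: "z \<in> topspace Z" and "e z r \<in> U"
    then obtain \<epsilon> where \<epsilon>: "\<epsilon> > 0" "\<And>v. dist v (e z r) < \<epsilon> \<Longrightarrow> v \<in> U"
      using \<open>open U\<close> by (auto simp: open_dist)
    define W where "W = {w \<in> topspace Z. e w r \<in> ball (e z r) (\<epsilon> / 2)}"
    \<comment> \<open>\<open>L\<close> carries no sign, so \<open>\<bar>L\<bar> + 1\<close> keeps
      the denominator positive; the other half of \<open>\<epsilon>\<close> is left for the change
      of \<open>z\<close>.\<close>
    define \<delta> where "\<delta> = \<epsilon> / (2 * (\<bar>L\<bar> + 1))"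
    have "openin Z W" unfolding W_def
      using cont[of r] by (rule openin_continuous_map_preimage) simp
    moreover have "(w, s) \<in> topspace Z \<times> UNIV \<and> e w s \<in> U" if w: "w \<in> W" "s \<in> ball r \<delta>" for w s
    proof -
      have "\<bar>e w s - e w r\<bar> \<le> L * \<bar>s - r\<bar>" using lip w W_def by auto
      also have "\<dots> \<le> (\<bar>L\<bar> + 1) * \<bar>s - r\<bar>" by (intro mult_right_mono) auto
      also have "\<dots> \<le> (\<bar>L\<bar> + 1) * \<delta>"
        using w(2) by (intro mult_left_mono) (auto simp: dist_real_def)
      also have "\<dots> = \<epsilon> / 2" by (simp add: \<delta>_def field_simps)
      finally have "\<bar>e w s - e w r\<bar> \<le> \<epsilon> / 2" .
      moreover have "\<bar>e z r - e w r\<bar> < \<epsilon> / 2"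
        using w(1) by (simp add: W_def dist_real_def)
      ultimately have "dist (e w s) (e z r) < \<epsilon>"
        unfolding dist_real_def by linarith
      with \<epsilon>(2) w show ?thesis by (simp add: W_def)
    qed
    ultimately have "openin (prod_topology Z euclideanreal) (W \<times> ball r \<delta>)" 
      "W \<times> ball r \<delta> \<subseteq> {p \<in> topspace Z \<times> UNIV. (case p of (z, r) \<Rightarrow> e z r) \<in> U}"
      by (auto simp: openin_prod_Times_iff)
    moreover have "(z, r) \<in> W \<times> ball r \<delta>" using z \<epsilon> by (simp add: W_def \<delta>_def)
    ultimately show "\<exists>T. openin (prod_topology Z euclideanreal) T \<and> (z, r) \<in> T \<and>
        T \<subseteq> {p \<in> topspace Z \<times> UNIV. (case p of (z, r) \<Rightarrow> e z r) \<in> U}"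
      by blast
  qed
  then show ?thesis by (auto simp: continuous_map_def)
qed

section \<open>Covers and the entropy of flows\<close>

lemma
  assumes "open_cover Z \<U>"
  shows open_cover_openin: "U \<in> \<U> \<Longrightarrow> openin Z U"
    and open_cover_Union: "\<Union>\<U> = topspace Z"
    and open_cover_covers: "z \<in> topspace Z \<Longrightarrow> \<exists>U. U \<in> \<U> \<and> z \<in> U"
  using assms unfolding open_cover_def by auto

lemma finite_subcover:
  assumes "compact_space Z" "open_cover Z \<U>"
  obtains \<V> where "\<V> \<subseteq> \<U>" "finite \<V>" "\<Union>\<V> = topspace Z"
proof -
  have "\<exists>\<V>. finite \<V> \<and> \<V> \<subseteq> \<U> \<and> topspace Z \<subseteq> \<Union>\<V>"
    using assms unfolding compact_space_def open_cover_def by (intro compactinD) auto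
  then obtain \<V> where \<V>: "finite \<V>" "\<V> \<subseteq> \<U>" "topspace Z \<subseteq> \<Union>\<V>" by blast
  have "\<Union>\<V> \<subseteq> topspace Z" using \<V>(2) assms(2) unfolding open_cover_def by blast
  with \<V> show thesis by (intro that[of \<V>]) auto
qed

lemma cover_number_attained:
  assumes "compact_space Z" "open_cover Z \<U>"
  obtains \<V> where "\<V> \<subseteq> \<U>" "finite \<V>" "card \<V> = cover_number Z \<U>" "\<Union>\<V> = topspace Z"
proof -
  obtain \<V> where "\<V> \<subseteq> \<U>" "finite \<V>" "\<Union>\<V> = topspace Z"
    by (rule finite_subcover[OF assms])
  then have "\<exists>m \<V>. \<V> \<subseteq> \<U> \<and> finite \<V> \<and> card \<V> = m \<and> \<Union>\<V> = topspace Z" by blast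
  from LeastI_ex[OF this] that show thesis unfolding cover_number_def by blast
qed

lemma cover_number_pos:
  assumes "compact_space Z" "open_cover Z \<U>" "topspace Z \<noteq> {}"
  shows "0 < cover_number Z \<U>"
proof -
  obtain \<V> where "finite \<V>" "card \<V> = cover_number Z \<U>" "\<Union>\<V> = topspace Z"
    by (rule cover_number_attained[OF assms(1,2)])
  moreover from this have "\<V> \<noteq> {}" using assms(3) by (metis Union_empty)
  ultimately show ?thesis using card_gt_0_iff[of \<V>] by metis
qed

lemma cover_number_le:
  assumes I: "finite I" and ref: "\<And>i. i \<in> I \<Longrightarrow> S i = {} \<or> (\<exists>U\<in>\<U>. S i \<subseteq> U)"
    and cov: "topspace Z \<subseteq> (\<Union>i\<in>I. S i)" and U: "\<Union>\<U> = topspace Z"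
  shows "cover_number Z \<U> \<le> card I"
proof -
  define J where "J = {i \<in> I. S i \<noteq> {}}"
  have J: "finite J" "card J \<le> card I" unfolding J_def using I by (auto intro: card_mono)
  have "\<forall>i\<in>J. \<exists>U. U \<in> \<U> \<and> S i \<subseteq> U" using ref unfolding J_def by blast
  from bchoice[OF this] obtain g where g: "\<And>i. i \<in> J \<Longrightarrow> g i \<in> \<U> \<and> S i \<subseteq> g i" by blast
  have "z \<in> \<Union>(g ` J)" if z: "z \<in> topspace Z" for z
  proof -
    obtain i where "i \<in> I" "z \<in> S i" using subsetD[OF cov z] by blast
    then have "i \<in> J" by (auto simp: J_def)
    with g \<open>z \<in> S i\<close> show ?thesis by blast
  qed
  moreover have "\<Union>(g ` J) \<subseteq> topspace Z" using g unfolding U[symmetric] by (intro Union_mono) auto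
  ultimately have "\<Union>(g ` J) = topspace Z" by blast
  then have "cover_number Z \<U> \<le> card (g ` J)"
    unfolding cover_number_def using g J(1) by (intro Least_le exI[of _ "g ` J"] conjI image_subsetI finite_imageI) auto
  then show ?thesis using card_image_le[OF J(1), of g] J(2) by linarith
qed

lemma continuous_map_in_topspace: "continuous_map X Y f \<Longrightarrow> x \<in> topspace X \<Longrightarrow> f x \<in> topspace Y"
  by (auto simp: continuous_map_def)

lemma open_cover_iterated_join:
  assumes f: "continuous_map Z Z f" and U: "open_cover Z \<U>"
  shows "open_cover Z (iterated_join Z f \<U> n)"
proof -
  have fn: "continuous_map Z Z (f ^^ i)" for i
  proof (induction i)
    case (Suc i)
    then show ?case using continuous_map_compose[OF Suc f] by (simp add: comp_def)
  qed (simp add: id_def)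
  have ops: "openin Z W" if W: "W \<in> iterated_join Z f \<U> n" for W
  proof -
    obtain c where c: "W = {z \<in> topspace Z. \<forall>i<n. (f ^^ i) z \<in> c i}" "\<forall>i<n. c i \<in> \<U>"
      using W unfolding iterated_join_def by auto
    show ?thesis
    \<comment> \<open>For \<open>n = 0\<close> the member is the whole space, whereas the
      intersection over no indices would be \<open>UNIV\<close>.\<close>
    proof (cases "n = 0")
      case False
      have "openin Z (\<Inter>i<n. {z \<in> topspace Z. (f ^^ i) z \<in> c i})"
        using False c(2)
        by (intro openin_INT2 openin_continuous_map_preimage[OF fn] open_cover_openin[OF U]) auto
      moreover have "(\<Inter>i<n. {z \<in> topspace Z. (f ^^ i) z \<in> c i}) = W"
        unfolding c(1) using False by auto
      ultimately show ?thesis by simp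
    qed (simp add: c(1))
  qed
  have cov: "z \<in> \<Union>(iterated_join Z f \<U> n)" if z: "z \<in> topspace Z" for z
  proof -
    have "\<forall>i. \<exists>U. U \<in> \<U> \<and> (f ^^ i) z \<in> U"
      using open_cover_covers[OF U continuous_map_in_topspace[OF fn z]] by blast
    from choice[OF this] obtain c where c: "\<And>i. c i \<in> \<U>" "\<And>i. (f ^^ i) z \<in> c i" by blast
    have "{z \<in> topspace Z. \<forall>i<n. (f ^^ i) z \<in> c i} \<in> iterated_join Z f \<U> n"
      unfolding iterated_join_def mem_Collect_eq using c(1) by (intro exI[of _ c]) simp
    moreover have "z \<in> {z \<in> topspace Z. \<forall>i<n. (f ^^ i) z \<in> c i}" using z c(2) by simp
    ultimately show ?thesis by (rule UnionI)
  qed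
  have "\<Union>(iterated_join Z f \<U> n) = topspace Z"
  proof
    show "\<Union>(iterated_join Z f \<U> n) \<subseteq> topspace Z"
      by (intro Union_least openin_subset ops)
  qed (use cov in blast)
  with ops show ?thesis unfolding open_cover_def by simp
qed

section \<open>Flows and their uniformity over compact time intervals\<close>

lemma
  assumes "flow Z \<Phi>"
  shows flow_compact: "compact_space Z"
    and flow_jointly_continuous: "continuous_map (prod_topology Z euclideanreal) Z (\<lambda>(z, t). \<Phi> t z)"
    and flow_0: "z \<in> topspace Z \<Longrightarrow> \<Phi> 0 z = z"
    and flow_add: "z \<in> topspace Z \<Longrightarrow> \<Phi> t (\<Phi> s z) = \<Phi> (t + s) z"
proof -
  note * = assms[unfolded flow_def]
  show "compact_space Z" by (rule conjunct1[OF *])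
  show "continuous_map (prod_topology Z euclideanreal) Z (\<lambda>(z, t). \<Phi> t z)"
    by (rule conjunct1[OF conjunct2[OF conjunct2[OF *]]])
  show "z \<in> topspace Z \<Longrightarrow> \<Phi> 0 z = z"
    by (rule conjunct1[OF conjunct2[OF conjunct2[OF conjunct2[OF *]]], rule_format])
  show "z \<in> topspace Z \<Longrightarrow> \<Phi> t (\<Phi> s z) = \<Phi> (t + s) z"
    by (rule conjunct2[OF conjunct2[OF conjunct2[OF conjunct2[OF *]]], rule_format])
qed

lemma flow_continuous:
  assumes "flow Z \<Phi>"
  shows "continuous_map Z Z (\<Phi> t)"
proof -
  have "continuous_map Z (prod_topology Z euclideanreal) (\<lambda>z. (z, t))"
    by (simp add: continuous_map_pairwise comp_def)
  from continuous_map_compose[OF this flow_jointly_continuous[OF assms]] show ?thesis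
    by (simp add: comp_def)
qed

lemma flow_in_topspace:
  assumes "flow Z \<Phi>" "z \<in> topspace Z"
  shows "\<Phi> t z \<in> topspace Z"
  by (rule continuous_map_in_topspace[OF flow_continuous[OF assms(1)] assms(2)])

lemma flow_funpow:
  assumes "flow Z \<Phi>" "z \<in> topspace Z"
  shows "(\<Phi> t ^^ n) z = \<Phi> (real n * t) z"
proof (induction n)
  case 0
  then show ?case using flow_0[OF assms] by simp
next
  case (Suc n)
  have "(\<Phi> t ^^ Suc n) z = \<Phi> t (\<Phi> (real n * t) z)" by (simp only: funpow.simps comp_apply Suc)
  also have "\<dots> = \<Phi> (t + real n * t) z" by (rule flow_add[OF assms])
  also have "t + real n * t = real (Suc n) * t" by (simp only: of_nat_Suc distrib_right mult_1_left)
  finally show ?case .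
qed

lemma openin_prod_euclideanreal_obtain:
  assumes "openin (prod_topology Z euclideanreal) S" "(z, s) \<in> S"
  obtains W \<delta> where "openin Z W" "z \<in> W" "\<delta> > 0" "\<And>w r. w \<in> W \<Longrightarrow> \<bar>r - s\<bar> < \<delta> \<Longrightarrow> (w, r) \<in> S"
proof -
  have "\<exists>W B. openin Z W \<and> openin euclideanreal B \<and> z \<in> W \<and> s \<in> B \<and> W \<times> B \<subseteq> S"
    by (rule openin_prod_topology_alt[THEN iffD1, OF assms(1), rule_format, OF assms(2)])
  then obtain W B where WB: "openin Z W" "open B" "z \<in> W" "s \<in> B" "W \<times> B \<subseteq> S"
    by (elim exE conjE) (simp only: open_openin[symmetric])
  obtain \<delta> where \<delta>: "\<delta> > 0" "ball s \<delta> \<subseteq> B"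
    using openE[OF WB(2,4)] by blast
  show thesis
  proof (rule that[OF WB(1,3) \<delta>(1)])
    fix w r assume "w \<in> W" "\<bar>r - s\<bar> < \<delta>"
    moreover from this have "r \<in> B" using \<delta>(2) by (auto simp: dist_real_def abs_minus_commute)
    ultimately show "(w, r) \<in> S" using WB(5) by blast
  qed
qed
lemma finite_positive_lower_bound:
  fixes f :: "'a \<Rightarrow> real"
  assumes "finite F" "\<And>x. x \<in> F \<Longrightarrow> 0 < f x"
  obtains \<epsilon> where "0 < \<epsilon>" "\<And>x. x \<in> F \<Longrightarrow> \<epsilon> \<le> f x"
proof (rule that)
  show "0 < Min (insert 1 (f ` F))" using assms by (simp add: Min_gr_iff)
  show "Min (insert 1 (f ` F)) \<le> f x" if "x \<in> F" for x
    using assms(1) that by (intro Min_le) auto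
qed

text \<open>This replaces uniform continuity and a Lebesgue number, without a metric. Compactness of
  \<open>{0..t}\<close> gives one neighbourhood and one \<open>\<delta>\<close> for a fixed point;
  compactness of \<open>Z\<close> then leaves finitely many points, hence a common
  \<open>\<delta>\<close>. The set \<open>U\<close> may depend on \<open>V\<close> and
  \<open>s\<close>, but neither on the point of \<open>V\<close> nor on the nearby time
  \<open>r\<close>.\<close>

lemma flow_uniform_cover:
  assumes \<Phi>: "flow Z \<Phi>" and U: "open_cover Z \<U>"
  obtains \<V> and \<delta> :: real where "open_cover Z \<V>" "\<delta> > 0"
    "\<And>V s. V \<in> \<V> \<Longrightarrow> s \<in> {0..t} \<Longrightarrow> \<exists>U\<in>\<U>. \<forall>z\<in>V. \<forall>r. \<bar>r - s\<bar> < \<delta> \<longrightarrow> \<Phi> r z \<in> U"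
proof -
  note cont = flow_jointly_continuous[OF \<Phi>] and comp = flow_compact[OF \<Phi>]
  define good where "good W \<delta> \<longleftrightarrow> openin Z W \<and> \<delta> > 0 \<and>
    (\<forall>s\<in>{0..t}. \<exists>U\<in>\<U>. \<forall>z\<in>W. \<forall>r. \<bar>r - s\<bar> < \<delta> \<longrightarrow> \<Phi> r z \<in> U)" for W and \<delta> :: real
  have loc: "\<exists>W \<delta>. z \<in> W \<and> good W \<delta>" if z: "z \<in> topspace Z" for z
  proof -
    define near where "near s W \<delta> \<longleftrightarrow> openin Z W \<and> z \<in> W \<and> \<delta> > 0 \<and>
      (\<exists>U\<in>\<U>. \<forall>w\<in>W. \<forall>r. \<bar>r - s\<bar> < \<delta> \<longrightarrow> \<Phi> r w \<in> U)" for s \<delta> :: real and W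
    have "\<exists>W \<delta>. near s W \<delta>" for s
    proof -
      obtain U where U': "U \<in> \<U>" "\<Phi> s z \<in> U"
        using open_cover_covers[OF U flow_in_topspace[OF \<Phi> z]] by blast
      have ope: "openin (prod_topology Z euclideanreal)
          {p \<in> topspace (prod_topology Z euclideanreal). (\<lambda>(z, t). \<Phi> t z) p \<in> U}"
        by (rule openin_continuous_map_preimage[OF cont open_cover_openin[OF U U'(1)]])
      have mem: "(z, s) \<in> {p \<in> topspace (prod_topology Z euclideanreal). (\<lambda>(z, t). \<Phi> t z) p \<in> U}"
        using z U'(2) by simp
      obtain W \<delta> where W: "openin Z W" "z \<in> W" "\<delta> > 0" and
        mem: "\<And>w r. w \<in> W \<Longrightarrow> \<bar>r - s\<bar> < \<delta> \<Longrightarrow>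
          (w, r) \<in> {p \<in> topspace (prod_topology Z euclideanreal). (\<lambda>(z, t). \<Phi> t z) p \<in> U}"
        by (rule openin_prod_euclideanreal_obtain[OF ope mem]) (rule that)
      have "\<Phi> r w \<in> U" if "w \<in> W" "\<bar>r - s\<bar> < \<delta>" for w r
        using mem[OF that] by simp
      with W U'(1) have "near s W \<delta>" unfolding near_def by (intro conjI bexI[of _ U]) auto
      then show ?thesis by blast
    qed
    then obtain W \<delta> where near: "\<And>s. near s (W s) (\<delta> s)" by metis
    have W: "openin Z (W s)" "z \<in> W s" "\<delta> s > 0"
      and WU: "\<exists>U\<in>\<U>. \<forall>w\<in>W s. \<forall>r. \<bar>r - s\<bar> < \<delta> s \<longrightarrow> \<Phi> r w \<in> U" for s
      using near[of s] unfolding near_def by auto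
    \<comment> \<open>Half radii, so that a time close to \<open>s\<close> is still within the full
      radius of the centre whose ball contains \<open>s\<close>.\<close>
    obtain F where F: "finite F" "{0..t} \<subseteq> (\<Union>s\<in>F. ball s (\<delta> s / 2))"
    proof (rule compactE_image[of "{0..t}" UNIV "\<lambda>s. ball s (\<delta> s / 2)"])
      show "{0..t} \<subseteq> (\<Union>s\<in>UNIV. ball s (\<delta> s / 2))"
      proof
        fix r assume "r \<in> {0..t}"
        have "r \<in> ball r (\<delta> r / 2)" using W(3)[of r] by simp
        then show "r \<in> (\<Union>s\<in>UNIV. ball s (\<delta> s / 2))" by blast
      qed
    qed auto
    obtain \<epsilon> where \<epsilon>: "\<epsilon> > 0" "\<And>s. s \<in> F \<Longrightarrow> \<epsilon> \<le> \<delta> s / 2"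
      using finite_positive_lower_bound[of F "\<lambda>s. \<delta> s / 2"] F(1) W(3) by auto
    \<comment> \<open>The factor \<open>topspace Z\<close> matters if \<open>F\<close> is empty,
      which is possible for \<open>t < 0\<close>.\<close>
    define V where "V = topspace Z \<inter> (\<Inter>s\<in>F. W s)"
    have "openin Z V"
      unfolding V_def Int_commute[of "topspace Z"] by (rule openin_INT[OF F(1) W(1)])
    moreover have "\<exists>U\<in>\<U>. \<forall>w\<in>V. \<forall>r. \<bar>r - s\<bar> < \<epsilon> \<longrightarrow> \<Phi> r w \<in> U" if s: "s \<in> {0..t}" for s
    proof -
      obtain s' where s': "s' \<in> F" "\<bar>s - s'\<bar> < \<delta> s' / 2"
        using F(2) s by (auto simp: dist_real_def abs_minus_commute)
      obtain U where U': "U \<in> \<U>" "\<And>w r. w \<in> W s' \<Longrightarrow> \<bar>r - s'\<bar> < \<delta> s' \<Longrightarrow> \<Phi> r w \<in> U"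
        using WU[of s'] by blast
      have "\<Phi> r w \<in> U" if "w \<in> V" "\<bar>r - s\<bar> < \<epsilon>" for w r
      proof (rule U'(2))
        show "w \<in> W s'" using that(1) s'(1) by (auto simp: V_def)
        show "\<bar>r - s'\<bar> < \<delta> s'" using that(2) \<epsilon>(2)[OF s'(1)] s'(2) by linarith
      qed
      then show ?thesis using U'(1) by blast
    qed
    moreover have "z \<in> V" using z W by (simp add: V_def)
    ultimately show ?thesis using \<epsilon>(1) unfolding good_def by blast
  qed
  then obtain W \<delta> where W: "\<And>z. z \<in> topspace Z \<Longrightarrow> z \<in> W z \<and> good (W z) (\<delta> z)" by metis
  have "open_cover Z (W ` topspace Z)"
    using W openin_subset unfolding open_cover_def good_def by blast
  then obtain \<V> where \<V>: "\<V> \<subseteq> W ` topspace Z" "finite \<V>" "\<Union>\<V> = topspace Z"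
    by (rule finite_subcover[OF comp])
  then obtain F where F: "F \<subseteq> topspace Z" "finite F" "\<V> = W ` F"
    by (meson finite_subset_image)
  have "0 < \<delta> z" if "z \<in> F" for z using W[of z] F(1) that unfolding good_def by blast
  then obtain \<epsilon> where \<epsilon>: "\<epsilon> > 0" "\<And>z. z \<in> F \<Longrightarrow> \<epsilon> \<le> \<delta> z"
    using finite_positive_lower_bound[of F \<delta>] F(2) by auto
  show thesis
  proof (rule that[of \<V> \<epsilon>])
    show "open_cover Z \<V>" using \<V> F W unfolding open_cover_def good_def by blast
    show "\<exists>U\<in>\<U>. \<forall>z\<in>V. \<forall>r. \<bar>r - s\<bar> < \<epsilon> \<longrightarrow> \<Phi> r z \<in> U" if V: "V \<in> \<V>" and s: "s \<in> {0..t}" for V s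
    proof -
      obtain z where z: "z \<in> F" "V = W z" using V F(3) by blast
      then have "\<exists>U\<in>\<U>. \<forall>w\<in>W z. \<forall>r. \<bar>r - s\<bar> < \<delta> z \<longrightarrow> \<Phi> r w \<in> U"
        using W F(1) s unfolding good_def by blast
      then show ?thesis using \<epsilon>(2)[OF z(1)] z(2) by (meson order_less_le_trans)
    qed
  qed (rule \<epsilon>(1))
qed

section \<open>Exponential rates and the entropy of the time maps\<close>

lemma cover_entropy_le:
  assumes "\<And>\<epsilon>. 0 < \<epsilon> \<Longrightarrow> \<exists>C. eventually (\<lambda>n.
    ln (real (cover_number Z (iterated_join Z f \<U> n))) \<le> (h + \<epsilon>) * real n + C) sequentially"
  shows "cover_entropy Z f \<U> \<le> ereal h"
proof (rule ereal_le_epsilon2)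
  fix e :: real assume e: "0 < e"
  show "cover_entropy Z f \<U> \<le> ereal h + ereal e"
  proof -
    let ?a = "\<lambda>n. ln (real (cover_number Z (iterated_join Z f \<U> n)))"
    \<comment> \<open>Half of \<open>e\<close> goes to the rate; the other half will absorb
      \<open>C / n\<close>.\<close>
    obtain C where C: "eventually (\<lambda>n. ?a n \<le> (h + e / 2) * real n + C) sequentially"
      using assms[of "e / 2"] e by auto
    have "(\<lambda>n. C / real n) \<longlonglongrightarrow> 0" by (rule lim_const_over_n)
    then have "eventually (\<lambda>n. C / real n < e / 2) sequentially"
      using e by (intro order_tendstoD(2)) auto
    with C eventually_gt_at_top[of 0]
    have "eventually (\<lambda>n. ereal (?a n / real n) \<le> ereal (h + e)) sequentially"
    proof eventually_elim
      case (elim n)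
      have "?a n / real n \<le> ((h + e / 2) * real n + C) / real n"
        using elim by (intro divide_right_mono) auto
      also have "\<dots> = h + e / 2 + C / real n" using elim by (simp add: add_divide_distrib)
      also have "\<dots> \<le> h + e" using elim by linarith
      finally show ?case by (simp only: ereal_less_eq)
    qed
    then have "cover_entropy Z f \<U> \<le> ereal (h + e)"
      unfolding cover_entropy_def by (rule Limsup_bounded)
    then show ?thesis by simp
  qed
qed

lemma eventually_le_of_cover_entropy:
  assumes "cover_entropy Z f \<U> \<le> ereal h" "h < h'"
  shows "eventually (\<lambda>n. ln (real (cover_number Z (iterated_join Z f \<U> n))) \<le> h' * real n) sequentially"
proof -
  let ?a = "\<lambda>n. ln (real (cover_number Z (iterated_join Z f \<U> n)))"
  have "limsup (\<lambda>n. ereal (?a n / real n)) < ereal h'"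
    using assms unfolding cover_entropy_def by (metis le_less_trans less_ereal.simps(1))
  from Limsup_lessD[OF this] eventually_gt_at_top[of 0] show ?thesis
    by eventually_elim (simp add: pos_divide_less_eq)
qed

lemma subset_iterated_join:
  assumes "flow Z \<Phi>" "W \<subseteq> topspace Z"
    and sub: "\<And>i. i < n \<Longrightarrow> \<exists>U\<in>\<U>. \<forall>z\<in>W. \<Phi> (real i * s) z \<in> U"
  shows "\<exists>U\<in>iterated_join Z (\<Phi> s) \<U> n. W \<subseteq> U"
proof -
  have "\<forall>i. \<exists>U. i < n \<longrightarrow> U \<in> \<U> \<and> (\<forall>z\<in>W. \<Phi> (real i * s) z \<in> U)" using sub by blast
  from choice[OF this] obtain d where
    d: "\<And>i. i < n \<Longrightarrow> d i \<in> \<U>" "\<And>i z. i < n \<Longrightarrow> z \<in> W \<Longrightarrow> \<Phi> (real i * s) z \<in> d i" by blast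
  have "{z \<in> topspace Z. \<forall>i<n. (\<Phi> s ^^ i) z \<in> d i} \<in> iterated_join Z (\<Phi> s) \<U> n"
    unfolding iterated_join_def mem_Collect_eq using d(1) by (intro exI[of _ d]) simp
  moreover have "W \<subseteq> {z \<in> topspace Z. \<forall>i<n. (\<Phi> s ^^ i) z \<in> d i}"
  proof
    fix z assume z: "z \<in> W"
    with assms(2) have "z \<in> topspace Z" by blast
    then show "z \<in> {z \<in> topspace Z. \<forall>i<n. (\<Phi> s ^^ i) z \<in> d i}"
      using d(2)[OF _ z] by (simp add: flow_funpow[OF assms(1)])
  qed
  ultimately show ?thesis by blast
qed

lemma cover_entropy_le_topological_entropy:
  "open_cover Z \<U> \<Longrightarrow> cover_entropy Z f \<U> \<le> topological_entropy Z f"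
  unfolding topological_entropy_def by (rule SUP_upper) simp

text \<open>Division with remainder in time: \<open>i * s = j * t + r\<close> with \<open>r\<close>
  in \<open>{0..t}\<close>. The uniform cover handles the remainder \<open>r\<close>, so an
  itinerary of the time-\<open>t\<close> map with respect to \<open>\<V>\<close> of length about
  \<open>n * s / t\<close> determines one of length \<open>n\<close> of the time-\<open>s\<close>
  map with respect to \<open>\<U>\<close>. Exchanging \<open>s\<close> and \<open>t\<close> gives
  the reverse bound.\<close>

lemma flow_entropy_scaling_le:
  assumes \<Phi>: "flow Z \<Phi>" and s: "0 < s" and t: "0 < t"
    and h: "topological_entropy Z (\<Phi> t) \<le> ereal h" "0 \<le> h"
  shows "topological_entropy Z (\<Phi> s) \<le> ereal (s * h / t)"
  unfolding topological_entropy_def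
proof (rule SUP_least)
  fix \<U> assume "\<U> \<in> {\<U>. open_cover Z \<U>}"
  then have U: "open_cover Z \<U>" by simp
  note comp = flow_compact[OF \<Phi>]
  obtain \<V> \<delta> where V: "open_cover Z \<V>" "\<delta> > 0"
    "\<And>V r. V \<in> \<V> \<Longrightarrow> r \<in> {0..t} \<Longrightarrow> \<exists>U\<in>\<U>. \<forall>z\<in>V. \<forall>q. \<bar>q - r\<bar> < \<delta> \<longrightarrow> \<Phi> q z \<in> U"
    by (rule flow_uniform_cover[OF \<Phi> U, of t]) (rule that)
  \<comment> \<open>One more than the integer part of \<open>n * s / t\<close>, so that every
    quotient \<open>j\<close> arising from some \<open>i < n\<close> is below
    \<open>m n\<close>.\<close>
  define m where "m n = nat \<lfloor>real n * s / t\<rfloor> + 1" for n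
  have m: "real (m n) \<le> real n * s / t + 1" for n
    using s t by (simp add: m_def)
  have mlim: "filterlim m at_top sequentially"
  proof -
    have "filterlim (\<lambda>n. real n * (s / t)) at_top sequentially"
      by (rule filterlim_at_top_mult_tendsto_pos[OF tendsto_const _ filterlim_real_sequentially])
        (use s t in simp)
    then have "filterlim (\<lambda>n. nat \<lfloor>real n * (s / t)\<rfloor>) at_top sequentially"
      by (intro filterlim_compose[OF filterlim_nat_sequentially]
          filterlim_compose[OF filterlim_floor_sequentially])
    then show ?thesis
      unfolding m_def by (rule filterlim_at_top_mono) simp
  qed
  have le: "cover_number Z (iterated_join Z (\<Phi> s) \<U> n) \<le> cover_number Z (iterated_join Z (\<Phi> t) \<V> (m n))" for n
  proof -
    obtain \<W> where W: "\<W> \<subseteq> iterated_join Z (\<Phi> t) \<V> (m n)" "finite \<W>"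
      "card \<W> = cover_number Z (iterated_join Z (\<Phi> t) \<V> (m n))" "\<Union>\<W> = topspace Z"
      by (rule cover_number_attained[OF comp open_cover_iterated_join[OF flow_continuous[OF \<Phi>] V(1)]])
    have "cover_number Z (iterated_join Z (\<Phi> s) \<U> n) \<le> card \<W>"
    proof (rule cover_number_le[where S = "\<lambda>W. W"])
      show "\<Union>(iterated_join Z (\<Phi> s) \<U> n) = topspace Z"
        by (intro open_cover_Union open_cover_iterated_join flow_continuous \<Phi> U)
      fix W assume "W \<in> \<W>"
      then obtain c where c: "W = {z \<in> topspace Z. \<forall>i<m n. (\<Phi> t ^^ i) z \<in> c i}" "\<And>i. i < m n \<Longrightarrow> c i \<in> \<V>"
        using W(1) unfolding iterated_join_def by auto
      have "\<exists>U\<in>\<U>. \<forall>z\<in>W. \<Phi> (real i * s) z \<in> U" if i: "i < n" for i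
      proof -
        define j where "j = nat \<lfloor>real i * s / t\<rfloor>"
        define r where "r = real i * s - real j * t"
        have j: "real j \<le> real i * s / t" "real i * s / t < real j + 1"
          unfolding j_def using s t by (simp_all add: of_nat_nat)
        then have r: "r \<in> {0..t}" using t by (simp add: r_def field_simps)
        have "real i * s / t \<le> real n * s / t"
          using i s t by (intro divide_right_mono mult_right_mono) auto
        then have jm: "j < m n" unfolding j_def m_def
          by (metis floor_mono nat_mono le_imp_less_Suc Suc_eq_plus1)
        obtain U where "U \<in> \<U>" "\<And>z. z \<in> c j \<Longrightarrow> \<Phi> r z \<in> U"
          using V(3)[OF c(2)[OF jm] r] V(2) by auto
        moreover have "\<Phi> (real i * s) z = \<Phi> r ((\<Phi> t ^^ j) z)" if "z \<in> topspace Z" for z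
          using flow_funpow[OF \<Phi> that] flow_add[OF \<Phi> that] by (simp add: r_def)
        ultimately show ?thesis using c(1) jm by (intro bexI[of _ U]) auto
      qed
      then have "W \<subseteq> topspace Z" "\<And>i. i < n \<Longrightarrow> \<exists>U\<in>\<U>. \<forall>z\<in>W. \<Phi> (real i * s) z \<in> U"
        using c(1) by auto
      then show "W = {} \<or> (\<exists>U\<in>iterated_join Z (\<Phi> s) \<U> n. W \<subseteq> U)"
        using subset_iterated_join[OF \<Phi>] by blast
    qed (use W in auto)
    with W(3) show ?thesis by simp
  qed
  show "cover_entropy Z (\<Phi> s) \<U> \<le> ereal (s * h / t)"
  \<comment> \<open>The passage to logarithms needs a positive cover number; the empty space has
    cover number 0 and is treated apart.\<close>
  proof (cases "topspace Z = {}")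
    case True
    have "cover_number Z (iterated_join Z (\<Phi> s) \<U> n) = 0" for n
      using cover_number_le[of "{}" "\<lambda>_. {}" "iterated_join Z (\<Phi> s) \<U> n" Z]
        open_cover_Union[OF open_cover_iterated_join[OF flow_continuous[OF \<Phi>] U, of s n]] True
      by simp
    then show ?thesis 
      using s t h by (intro cover_entropy_le exI[of _ 0]) (simp add: zero_le_mult_iff)
  next
    case False
    show ?thesis
    proof (rule cover_entropy_le)
      fix \<epsilon> :: real assume \<epsilon>: "0 < \<epsilon>"
      \<comment> \<open>Chosen so that \<open>h' * (s / t) = s * h / t + \<epsilon>\<close>. The
        summand 1 in the bound for \<open>m n\<close> then contributes the additive constant
        \<open>h'\<close>.\<close>
      define h' where "h' = h + \<epsilon> * t / s"
      have h': "h < h'" using \<epsilon> s t by (simp add: h'_def)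
      have "cover_entropy Z (\<Phi> t) \<V> \<le> ereal h"
        using cover_entropy_le_topological_entropy[OF V(1)] h(1) by (rule order_trans)
      from filterlim_iff[THEN iffD1, OF mlim, rule_format, OF eventually_le_of_cover_entropy[OF this h']]
      have "eventually (\<lambda>n. ln (real (cover_number Z (iterated_join Z (\<Phi> s) \<U> n)))
          \<le> (s * h / t + \<epsilon>) * real n + h') sequentially"
      proof eventually_elim
        case (elim n)
        have "0 < cover_number Z (iterated_join Z (\<Phi> s) \<U> n)"
          by (intro cover_number_pos comp open_cover_iterated_join flow_continuous \<Phi> U False)
        then have "ln (real (cover_number Z (iterated_join Z (\<Phi> s) \<U> n))) \<le> h' * real (m n)"
          using elim le[of n] by (intro order_trans[OF _ elim]) simp
        also have "\<dots> \<le> h' * (real n * s / t + 1)"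
          using m[of n] h' h(2) by (intro mult_left_mono) auto
        also have "\<dots> = (s * h / t + \<epsilon>) * real n + h'"
          using s t by (simp add: h'_def field_simps)
        finally show ?case .
      qed
      then show "\<exists>C. eventually (\<lambda>n. ln (real (cover_number Z (iterated_join Z (\<Phi> s) \<U> n)))
          \<le> (s * h / t + \<epsilon>) * real n + C) sequentially" by blast
    qed
  qed
qed

section \<open>Suspensions with constant roof\<close>

text \<open>Adjoining the all-ones sequence, which is invisible to \<^const>\<open>region\<close>, provides a point
  over \<open>\<Delta>\<close>; whether it already lies in \<open>X\<close> does not matter.\<close>

locale shift_suspension =
  fixes X :: "bisequence set" and c :: real
  assumes compact_insert: "compactin full_shift (insert (\<lambda>_. True) X)"
    and translate_mem: "\<And>k x. x \<in> X \<Longrightarrow> translate k x \<in> X"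
    and c_pos: "0 < c"
begin

abbreviation "roof \<equiv> (\<lambda>_::bisequence. c)"
abbreviation "R \<equiv> region X roof"
abbreviation "RT \<equiv> subtopology (prod_topology full_shift euclideanreal) R"
abbreviation "S \<equiv> suspension X roof"
abbreviation "Z \<equiv> compact_suspension X roof"

lemma region_iff: "(x, u) \<in> R \<longleftrightarrow> x \<in> X \<and> x \<noteq> (\<lambda>_. True) \<and> 0 \<le> u \<and> u \<le> c"
  by (auto simp: region_def punctured_def)

lemma topspace_RT [simp]: "topspace RT = R"
  by (simp add: topspace_subtopology)

text \<open>The row of bumps of the first coordinate, stretched so that one symbol lasts for time
  \<open>c\<close>, and read from the current height onwards. The argument \<open>s\<close> is time
  along the orbit.\<close>

definition code :: "bisequence \<times> real \<Rightarrow> real \<Rightarrow> real" where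
  "code p s = bump (fst p) ((snd p + s) / c)"

lemma code_glue:
  assumes "(p, q) \<in> glue X roof"
  shows "code p = code q"
proof
  fix s
  obtain x where pq: "p = (x, c)" "q = (shift x, 0)" using assms by (auto simp: glue_def)
  have "(c + s) / c = s / c + of_int 1" using c_pos by (simp add: field_simps)
  then show "code p s = code q s"
    unfolding code_def pq fst_conv snd_conv shift_eq_translate bump_add_int[symmetric] by simp
qed

text \<open>Equal codes force the two sequences to be translates by an integer
  \<open>k = (v - u) / c\<close>. Both heights lie in \<open>{0..c}\<close>, so \<open>k\<close> is
  0, 1 or -1: the points coincide or one gluing step joins them. Chains of gluings thus never have
  to be analysed; in the other direction \<open>code\<close> is invariant under each step.\<close>

lemma code_eq_iff:
  assumes "p \<in> R" "q \<in> R"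
  shows "code p = code q \<longleftrightarrow> (p, q) \<in> glue_equiv X roof"
proof
  assume "(p, q) \<in> glue_equiv X roof"
  then have "(p, q) \<in> (glue X roof \<union> (glue X roof)\<inverse>)\<^sup>*" by (simp add: glue_equiv_def)
  then show "code p = code q"
    by (induction rule: rtrancl_induct) (use code_glue in fastforce)+
next
  assume eq: "code p = code q"
  obtain x u y v where pq: "p = (x, u)" "q = (y, v)" by (cases p, cases q) auto
  have xy: "x \<in> X" "x \<noteq> (\<lambda>_. True)" "0 \<le> u" "u \<le> c" "y \<in> X" "y \<noteq> (\<lambda>_. True)" "0 \<le> v" "v \<le> c"
    using assms by (simp_all add: pq region_iff)
  have "bump x t = bump y (t + (v - u) / c)" for t
    using fun_cong[OF eq, of "c * t - u"] c_pos by (simp add: code_def pq field_simps)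
  then obtain k :: int where k: "(v - u) / c = of_int k" "x = translate k y"
    by (rule bump_shift_eqD[OF _ xy(2)])
  have "\<bar>(v - u) / c\<bar> \<le> 1" using xy c_pos by (simp add: abs_le_iff field_simps)
  then have "\<bar>k\<bar> \<le> 1" unfolding k(1) by linarith
  then consider "k = 0" | "k = 1" | "k = -1" by linarith
  then show "(p, q) \<in> glue_equiv X roof"
  proof cases
    case 1
    then have "p = q" using k c_pos by (simp add: pq)
    with assms show ?thesis by (simp add: glue_equiv_def)
  next
    case 2
    then have "v - u = c" using k c_pos by (simp add: field_simps)
    then have "v = c" "u = 0" using xy by linarith+
    with k 2 xy have "(q, p) \<in> glue X roof"
      by (simp add: glue_def pq punctured_def shift_eq_translate)
    with assms show ?thesis by (auto simp: glue_equiv_def)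
  next
    case 3
    then have "v - u = - c" using k c_pos by (simp add: field_simps)
    then have "v = 0" "u = c" using xy by linarith+
    moreover have "y = shift x" using k 3 by (simp add: shift_eq_translate translate_translate)
    ultimately have "(p, q) \<in> glue X roof" using xy
      by (simp add: glue_def pq punctured_def)
    with assms show ?thesis by (auto simp: glue_equiv_def)
  qed
qed

lemma code_nonzero:
  assumes "p \<in> R"
  shows "code p \<noteq> (\<lambda>_. 0)"
proof
  assume 0: "code p = (\<lambda>_. 0)"
  obtain x u where p: "p = (x, u)" by (cases p)
  then obtain i where i: "\<not> x i" using assms by (auto simp: region_iff)
  have "code p (c * (of_int i + 1 / 2) - u) = 1 / 2"
    using c_pos i by (simp add: code_def p)
  with 0 show False by simp
qed

text \<open>The flow is modelled by translations of functions on the line: the orbit of a point is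
  recorded by a row of bumps over the symbols 0, and \<open>\<Delta>\<close> by the zero function.\<close>

definition profile :: "(bisequence \<times> real) set option \<Rightarrow> real \<Rightarrow> real" where
  "profile z = (case z of None \<Rightarrow> \<lambda>_. 0 | Some A \<Rightarrow> code (SOME p. p \<in> A))"

lemma profile_None [simp]: "profile None = (\<lambda>_. 0)"
  by (simp add: profile_def)

lemma profile_Some:
  assumes "p \<in> R"
  shows "profile (Some (glue_equiv X roof `` {p})) = code p"
proof -
  define q where "q = (SOME q. q \<in> glue_equiv X roof `` {p})"
  have "p \<in> glue_equiv X roof `` {p}" using assms by (simp add: glue_equiv_def)
  then have "q \<in> glue_equiv X roof `` {p}" unfolding q_def by (rule someI)
  then have q: "(p, q) \<in> glue_equiv X roof" "q \<in> R" by (auto simp: glue_equiv_def)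
  have "code p = code q" using code_eq_iff[OF assms q(2)] q(1) by (rule iffD2)
  then show ?thesis unfolding profile_def option.case q_def[symmetric] by (rule sym)
qed

lemma profile_spoint: "p \<in> R \<Longrightarrow> profile (spoint X roof p) = code p"
  by (simp add: spoint_def profile_Some)

lemma quotient_map_suspension: "quotient_map RT S (\<lambda>p. glue_equiv X roof `` {p})"
  unfolding suspension_def
  by (rule quotient_map_quotient_topology) (simp only: topspace_RT equiv_glue_equiv)

lemma topspace_S: "topspace S = (\<lambda>p. glue_equiv X roof `` {p}) ` R"
  using quotient_imp_surjective_map[OF quotient_map_suspension] by simp

lemma topspace_Z: "topspace Z = insert None (spoint X roof ` R)"
  by (auto simp: compact_suspension_def topspace_S spoint_def image_iff)

lemma compact_space_Z: "compact_space Z"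
  by (simp add: compact_suspension_def)

lemma topspace_Z_cases:
  assumes "z \<in> topspace Z"
  obtains "z = None" | x u where "(x, u) \<in> R" "z = spoint X roof (x, u)"
  using assms by (auto simp: topspace_Z)

lemma inj_on_profile: "inj_on profile (topspace Z)"
proof (rule inj_onI)
  fix z w assume z: "z \<in> topspace Z" and w: "w \<in> topspace Z" and eq: "profile z = profile w"
  show "z = w"
  proof (cases "z = None \<or> w = None")
    case True
    with z w eq show ?thesis
      by (auto simp: topspace_Z profile_spoint code_nonzero code_nonzero[symmetric] dest: code_nonzero)
  next
    case False
    then obtain p q where pq: "p \<in> R" "q \<in> R" "z = spoint X roof p" "w = spoint X roof q"
      using z w by (auto simp: topspace_Z)
    then have "(p, q) \<in> glue_equiv X roof" using eq by (simp add: profile_spoint code_eq_iff)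
    then show ?thesis
      unfolding pq spoint_def using equiv_class_eq[OF equiv_glue_equiv] by simp
  qed
qed

lemma profile_lipschitz:
  assumes "z \<in> topspace Z"
  shows "\<bar>profile z r - profile z s\<bar> \<le> 1 / c * \<bar>r - s\<bar>"
  using assms
proof (cases rule: topspace_Z_cases)
  case (2 x u)
  have "\<bar>code (x, u) r - code (x, u) s\<bar> \<le> \<bar>(u + r) / c - (u + s) / c\<bar>"
    unfolding code_def fst_conv snd_conv by (rule bump_lipschitz)
  also have "(u + r) / c - (u + s) / c = (r - s) / c" by (simp add: diff_divide_distrib[symmetric])
  also have "\<bar>(r - s) / c\<bar> = 1 / c * \<bar>r - s\<bar>" using c_pos by simp
  finally show ?thesis by (simp add: 2 profile_spoint)
qed (use c_pos in simp)

lemma continuous_map_code: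
  "continuous_map (prod_topology full_shift euclideanreal) euclideanreal (\<lambda>p. code p r)"
proof -
  have ev: "continuous_map (prod_topology full_shift euclideanreal) euclideanreal (\<lambda>(x, t). bump x t)"
    using bump_lipschitz by (intro continuous_map_lipschitz_evaluation[where L = 1] continuous_map_bump) simp
  have "continuous_map (prod_topology full_shift euclideanreal) (prod_topology full_shift euclideanreal)
      (\<lambda>p. (fst p, (snd p + r) / c))"
    using c_pos by (intro continuous_map_pairedI continuous_map_fst continuous_map_real_divide
        continuous_map_add continuous_map_snd) auto
  from continuous_map_compose[OF this ev] show ?thesis
    by (simp add: comp_def code_def)
qed

text \<open>Away from \<Delta> this is the universal property of the quotient. At \<Delta>, where
  the value is 0, it means that the points whose value avoids a neighbourhood \<open>U\<close> of 0
  form a closed compact set.\<close>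

lemma continuous_map_profile: "continuous_map Z euclideanreal (\<lambda>z. profile z r)"
proof -
  have "continuous_map RT euclideanreal ((\<lambda>a. profile (Some a) r) \<circ> (\<lambda>p. glue_equiv X roof `` {p}))"
  proof (rule continuous_map_eq)
    show "continuous_map RT euclideanreal (\<lambda>p. code p r)"
      by (rule continuous_map_from_subtopology[OF continuous_map_code])
  qed (simp add: profile_Some)
  then have cont: "continuous_map S euclideanreal (\<lambda>a. profile (Some a) r)"
    using continuous_compose_quotient_map[OF quotient_map_suspension] by blast
  have "openin Z {z \<in> topspace Z. profile z r \<in> U}" if U: "openin euclideanreal U" for U
  proof (cases "0 \<in> U")
    case False
    have "openin S {a \<in> topspace S. profile (Some a) r \<in> U}"
      by (rule openin_continuous_map_preimage[OF cont U])
    moreover have "{z \<in> topspace Z. profile z r \<in> U} = Some ` {a \<in> topspace S. profile (Some a) r \<in> U}"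
      using False by (auto simp: compact_suspension_def)
    ultimately show ?thesis by (simp add: compact_suspension_def)
  next
    case True
    define C where "C = {a \<in> topspace S. profile (Some a) r \<in> - U}"
    \<comment> \<open>The region itself need not be compact, since the all-ones sequence is missing;
      putting it back makes the product compact.\<close>
    define K where "K = insert (\<lambda>_. True) X \<times> {0..c}"
    define P where "P = K \<inter> {p \<in> topspace (prod_topology full_shift euclideanreal). code p r \<in> - U}"
    have U': "closedin euclideanreal (- U)" using U by (simp add: closedin_def Compl_eq_Diff_UNIV[symmetric])
    have "closedin S C" unfolding C_def
      by (rule closedin_continuous_map_preimage[OF cont U'])
    moreover have "compactin S C"
    proof -
      have "compactin (prod_topology full_shift euclideanreal) K"
        unfolding K_def using compact_insert by (simp add: compactin_Times)
      then have "compactin (prod_topology full_shift euclideanreal) P"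
        unfolding P_def
        by (rule compact_Int_closedin) (rule closedin_continuous_map_preimage[OF continuous_map_code U'])
      \<comment> \<open>Over the all-ones sequence the code is 0, which lies in \<open>U\<close>, so
        the part of \<open>K\<close> cut out by \<open>- U\<close> stays inside the region.\<close>
      moreover have PR: "P = {p \<in> R. code p r \<in> - U}"
        using True by (auto simp: P_def K_def region_def punctured_def code_def)
      ultimately have "compactin RT P" by (simp add: compactin_subtopology subset_iff)
      then have "compactin S ((\<lambda>p. glue_equiv X roof `` {p}) ` P)"
        by (rule image_compactin[OF _ quotient_imp_continuous_map[OF quotient_map_suspension]])
      moreover have "(\<lambda>p. glue_equiv X roof `` {p}) ` P = C"
        unfolding PR C_def topspace_S by (auto simp: profile_Some)
      ultimately show ?thesis by simp
    qed
    moreover have "{z \<in> topspace Z. profile z r \<in> U} = insert None (Some ` (topspace S - C))"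
      using True by (auto simp: compact_suspension_def C_def)
    ultimately show ?thesis
      unfolding compact_suspension_def openin_Alexandroff_compactification by blast
  qed
  then show ?thesis by (simp add: continuous_map_def)
qed

section \<open>Metrizability of the compactified suspension\<close>

definition rational_profile :: "(bisequence \<times> real) set option \<Rightarrow> rat \<Rightarrow> real" where
  "rational_profile z q = profile z (of_rat q)"

text \<open>Rational arguments make the target a countable product of lines, which is metrizable.
  Nothing is lost, as Lipschitz functions are determined by their values on a dense set.\<close>

lemma inj_on_rational_profile: "inj_on rational_profile (topspace Z)"
proof (rule inj_onI)
  fix z w assume z: "z \<in> topspace Z" and w: "w \<in> topspace Z" and eq: "rational_profile z = rational_profile w"
  have "profile z r = profile w r" for r
  proof (rule ccontr)
    define d where "d = \<bar>profile z r - profile w r\<bar>"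
    assume "profile z r \<noteq> profile w r"
    \<comment> \<open>Within \<open>c * d / 2\<close> of \<open>r\<close> each profile moves by less
      than \<open>d / 2\<close>, so a gap of \<open>d\<close> at \<open>r\<close> cannot close at a
      rational.\<close>
    then have "r < r + c * d / 2" using c_pos by (simp add: d_def)
    then obtain q where q: "r < of_rat q" "of_rat q < r + c * d / 2"
      using of_rat_dense by blast
    have "profile z (of_rat q) = profile w (of_rat q)"
      using fun_cong[OF eq, of q] by (simp add: rational_profile_def)
    then have "d \<le> 1 / c * \<bar>r - of_rat q\<bar> + 1 / c * \<bar>r - of_rat q\<bar>"
      unfolding d_def using profile_lipschitz[OF z, of r "of_rat q"] profile_lipschitz[OF w, of r "of_rat q"]
      by linarith
    also have "\<dots> = 2 / c * (of_rat q - r)" using q by simp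
    also have "\<dots> < 2 / c * (c * d / 2)" using q c_pos by (intro mult_strict_left_mono) auto
    also have "\<dots> = d" using c_pos by simp
    finally show False by simp
  qed
  then show "z = w" by (intro inj_onD[OF inj_on_profile _ z w]) auto
qed

lemma continuous_map_rational_profile:
  assumes "\<And>r. continuous_map Y euclideanreal (\<lambda>y. profile (f y) r)"
  shows "continuous_map Y euclidean (\<lambda>y. rational_profile (f y))"
proof -
  have "continuous_map Y (product_topology (\<lambda>_. euclideanreal) UNIV) (\<lambda>y. rational_profile (f y))"
    using assms by (simp add: continuous_map_componentwise_UNIV rational_profile_def)
  then show ?thesis by (simp only: euclidean_product_topology)
qed

lemma closed_map_rational_profile: "closed_map Z euclidean rational_profile"
  by (rule continuous_imp_closed_map_gen[OF compact_space_Z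
        _ continuous_map_rational_profile[OF continuous_map_profile]])
    (simp add: Hausdorff_imp_kc_space)

lemma embedding_rational_profile: "embedding_map Z euclidean rational_profile"
  by (rule injective_closed_imp_embedding_map[OF continuous_map_rational_profile[OF continuous_map_profile]
        closed_map_rational_profile inj_on_rational_profile])

lemma metrizable_space_Z: "metrizable_space Z"
  using homeomorphic_metrizable_space[OF embedding_map_imp_homeomorphic_space[OF embedding_rational_profile]]
  by (simp add: metrizable_space_subtopology metrizable_space_euclidean)

text \<open>The embedding is closed, a continuous injection of a compact space into a Hausdorff one,
  so \<open>Z\<close> carries the topology induced by the evaluations. Continuity into the
  compactified quotient thereby becomes continuity of real functions.\<close>

lemma continuous_map_into_Z:
  assumes mem: "\<And>y. y \<in> topspace Y \<Longrightarrow> f y \<in> topspace Z"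
    and cont: "\<And>r. continuous_map Y euclideanreal (\<lambda>y. profile (f y) r)"
  shows "continuous_map Y Z f"
  unfolding continuous_map_closedin
proof (intro conjI ballI allI impI)
  fix C assume C: "closedin Z C"
  have "closedin euclidean (rational_profile ` C)"
    using closed_map_rational_profile C unfolding closed_map_def by blast
  from closedin_continuous_map_preimage[OF continuous_map_rational_profile[OF cont] this]
  have "closedin Y {y \<in> topspace Y. rational_profile (f y) \<in> rational_profile ` C}" .
  moreover have "rational_profile (f y) \<in> rational_profile ` C \<longleftrightarrow> f y \<in> C" if "y \<in> topspace Y" for y
    using inj_on_image_mem_iff[OF inj_on_rational_profile mem[OF that] closedin_subset[OF C]] .
  ultimately show "closedin Y {y \<in> topspace Y. f y \<in> C}" by (simp cong: conj_cong)
qed (use mem in auto)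

section \<open>The suspension flow as translation of profiles\<close>

definition translation :: "real \<Rightarrow> (bisequence \<times> real) set option \<Rightarrow> (bisequence \<times> real) set option" where
  "translation t z = inv_into (topspace Z) profile (\<lambda>s. profile z (s + t))"

text \<open>Translates of profiles are again profiles, which is what gives the inverse image in
  \<open>translation\<close> its meaning. With a constant roof no orbit runs out in finite
  time.\<close>

lemma profile_translate_mem:
  assumes "z \<in> topspace Z"
  shows "(\<lambda>s. profile z (s + t)) \<in> profile ` topspace Z"
  using assms
proof (cases rule: topspace_Z_cases)
  case 1
  then show ?thesis by (intro image_eqI[of _ _ None]) (simp_all add: topspace_Z)
next
  case (2 x u)
  \<comment> \<open>The number of complete turns through the roof; \<open>v\<close> is the height
    that remains.\<close>
  define k where "k = \<lfloor>(u + t) / c\<rfloor>"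
  define v where "v = u + t - of_int k * c"
  have "of_int k \<le> (u + t) / c" "(u + t) / c < of_int k + 1" unfolding k_def by linarith+
  then have v: "0 \<le> v" "v \<le> c" using c_pos by (simp_all add: v_def field_simps)
  have mem: "(translate k x, v) \<in> R"
    using 2 v by (simp add: region_iff translate_mem)
  have "(u + (s + t)) / c = (v + s) / c + of_int k" for s
    using c_pos by (simp add: v_def field_simps)
  then have "(\<lambda>s. profile z (s + t)) = profile (spoint X roof (translate k x, v))"
    using 2 mem by (simp add: profile_spoint code_def bump_add_int fun_eq_iff)
  moreover have "spoint X roof (translate k x, v) \<in> topspace Z" using mem by (simp add: topspace_Z)
  ultimately show ?thesis by (rule image_eqI)
qed

lemma
  assumes "z \<in> topspace Z"
  shows translation_mem: "translation t z \<in> topspace Z"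
    and profile_translation: "profile (translation t z) s = profile z (s + t)"
  unfolding translation_def
  using inv_into_into[OF profile_translate_mem[OF assms]] f_inv_into_f[OF profile_translate_mem[OF assms]]
  by (auto dest: fun_cong)

lemma translation_eqI:
  assumes "z \<in> topspace Z" "w \<in> topspace Z" "\<And>s. profile w s = profile z (s + t)"
  shows "translation t z = w"
  using assms by (intro inj_onD[OF inj_on_profile]) (auto simp: translation_mem profile_translation)

lemma continuous_map_translation:
  "continuous_map (prod_topology Z euclideanreal) Z (\<lambda>(z, t). translation t z)"
proof (rule continuous_map_into_Z)
  fix r
  have ev: "continuous_map (prod_topology Z euclideanreal) euclideanreal (\<lambda>(z, t). profile z t)"
    by (rule continuous_map_lipschitz_evaluation[OF continuous_map_profile profile_lipschitz])
  have "continuous_map (prod_topology Z euclideanreal) (prod_topology Z euclideanreal)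
      (\<lambda>p. (fst p, r + snd p))"
    by (intro continuous_map_pairedI continuous_map_fst continuous_map_add continuous_map_snd) auto
  from continuous_map_compose[OF this ev]
  show "continuous_map (prod_topology Z euclideanreal) euclideanreal
      (\<lambda>p. profile (case p of (z, t) \<Rightarrow> translation t z) r)"
    by (rule continuous_map_eq) (auto simp: profile_translation)
qed (auto simp: translation_mem)

lemma flow_translation: "flow Z translation"
  unfolding flow_def
proof (intro conjI allI ballI)
  show "translation 0 z = z" if "z \<in> topspace Z" for z
    using that by (intro translation_eqI) auto
  show "translation t (translation s z) = translation (t + s) z" if "z \<in> topspace Z" for t s z
    using that by (intro translation_eqI translation_mem) (auto simp: profile_translation algebra_simps)
qed (fact compact_space_Z metrizable_space_Z continuous_map_translation)+

lemma suspension_flow_translation: "suspension_flow X roof translation"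
  unfolding suspension_flow_def
proof (intro conjI allI ballI flow_translation)
  fix p assume "p \<in> R"
  then obtain x u where p: "p = (x, u)" "(x, u) \<in> R" by (cases p) auto
  have "translation t (spoint X roof (x, u)) = spoint X roof (x, u + t)" if t: "- u \<le> t" "t < c - u" for t
  proof (rule translation_eqI)
    have m: "(x, u + t) \<in> R" using p t by (simp add: region_iff)
    then show "spoint X roof (x, u) \<in> topspace Z" "spoint X roof (x, u + t) \<in> topspace Z"
      using p by (auto simp: topspace_Z)
    show "profile (spoint X roof (x, u + t)) s = profile (spoint X roof (x, u)) (s + t)" for s
      using p m by (simp add: profile_spoint code_def add_ac)
  qed
  then show "case p of (x, u) \<Rightarrow> \<forall>t. - u \<le> t \<and> t < c - u \<longrightarrow>
      translation t (spoint X roof (x, u)) = spoint X roof (x, u + t)"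
    by (simp add: p)
next
  show "translation t None = None" for t
    by (rule translation_eqI) (simp_all add: topspace_Z)
qed

lemma roof_function_const: "roof_function X roof"
  using c_pos by (simp add: roof_function_def)

end

section \<open>Word complexity\<close>

definition initial_word :: "nat \<Rightarrow> bisequence \<Rightarrow> bool list" where
  "initial_word n x = map (\<lambda>i. x (int i)) [0..<n]"

lemma initial_word_eq_iff: "initial_word n x = initial_word n y \<longleftrightarrow> (\<forall>i<n. x (int i) = y (int i))"
  by (auto simp: initial_word_def list_eq_iff_nth_eq)

text \<open>For a shift-invariant set the words at the origin are all subwords of length
  \<open>n\<close>, whatever their position.\<close>

definition complexity :: "bisequence set \<Rightarrow> nat \<Rightarrow> nat" where
  "complexity Y n = card (initial_word n ` Y)"

lemma finite_initial_words: "finite (initial_word n ` Y)"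
  by (rule finite_subset[OF _ finite_lists_length_eq[of UNIV n]]) (auto simp: initial_word_def)

lemma card_bool_lists: "card {v :: bool list. length v = n} = 2 ^ n"
  using card_lists_length_eq[of "UNIV :: bool set" n] by simp

lemma complexity_pos: "Y \<noteq> {} \<Longrightarrow> 0 < complexity Y n"
  by (simp add: complexity_def card_gt_0_iff finite_initial_words)

text \<open>The last \<open>m\<close> symbols allow at most \<open>2 ^ m\<close> choices. This pays
  for the margin of \<open>2 * k\<close> symbols that a cover of the suspension requires around a
  word.\<close>

lemma complexity_add_le: "complexity Y (n + m) \<le> complexity Y n * 2 ^ m"
proof -
  have "initial_word (n + m) ` Y \<subseteq> (\<lambda>(v, w). v @ w) ` (initial_word n ` Y \<times> {v. length v = m})"
  proof
    fix w assume "w \<in> initial_word (n + m) ` Y"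
    then obtain x where x: "x \<in> Y" "w = initial_word (n + m) x" by blast
    have "w = initial_word n x @ map (\<lambda>i. x (int i)) [n..<n + m]"
      by (simp add: x initial_word_def upt_add_eq_append[of 0 n m])
    with x(1) show "w \<in> (\<lambda>(v, w). v @ w) ` (initial_word n ` Y \<times> {v. length v = m})"
      by (intro image_eqI[of _ _ "(initial_word n x, map (\<lambda>i. x (int i)) [n..<n + m])"]) auto
  qed
  moreover have "finite (initial_word n ` Y \<times> {v :: bool list. length v = m})"
    using finite_lists_length_eq[of "UNIV :: bool set" m] by (simp add: finite_initial_words)
  ultimately have "complexity Y (n + m) \<le> card (initial_word n ` Y \<times> {v :: bool list. length v = m})"
    unfolding complexity_def by (intro surj_card_le)
  then show ?thesis by (simp add: card_cartesian_product complexity_def card_bool_lists)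
qed

lemma complexity_le: "complexity Y n \<le> 2 ^ n"
proof -
  have "complexity Y 0 \<le> 1"
    unfolding complexity_def using card_mono[of "{[]}" "initial_word 0 ` Y"] by (auto simp: initial_word_def)
  with complexity_add_le[of Y 0 n] show ?thesis
    by (metis add_0 le_trans mult_1 mult_le_mono1)
qed

text \<open>The topological entropy, when the set is a subshift. The limit superior matches
  \<open>cover_entropy\<close>, so bounds valid for each \<open>n\<close> pass to it
  directly.\<close>

definition growth :: "bisequence set \<Rightarrow> ereal" where
  "growth Y = limsup (\<lambda>n. ereal (ln (real (complexity Y n)) / real n))"

section \<open>Cylinders as a uniform neighbourhood basis\<close>

lemma openin_cylinder: "openin full_shift {y. \<forall>i. \<bar>i\<bar> \<le> int k \<longrightarrow> y i = x i}"
proof -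
  have "openin full_shift {y \<in> topspace full_shift. y i \<in> {x i}}" for i
    by (rule openin_continuous_map_preimage[OF continuous_map_coordinate]) simp
  then have "openin full_shift (\<Inter>i\<in>{- int k..int k}. {y. y i = x i})"
    by (intro openin_INT2) auto
  moreover have "(\<Inter>i\<in>{- int k..int k}. {y. y i = x i}) = {y. \<forall>i. \<bar>i\<bar> \<le> int k \<longrightarrow> y i = x i}"
    by (auto simp: abs_le_iff)
  ultimately show ?thesis by simp
qed

lemma cylinder_basis:
  assumes "openin full_shift T" "x \<in> T"
  shows "\<exists>k::nat. \<forall>y. (\<forall>i. \<bar>i\<bar> \<le> int k \<longrightarrow> y i = x i) \<longrightarrow> y \<in> T"
proof -
  obtain U where U: "finite {i. U i \<noteq> UNIV}" "x \<in> Pi\<^sub>E UNIV U" "Pi\<^sub>E UNIV U \<subseteq> T"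
    using assms unfolding full_shift_def openin_product_topology_alt by auto
  define k where "k = Max (insert 0 ((\<lambda>i. nat \<bar>i\<bar>) ` {i. U i \<noteq> UNIV}))"
  have k: "\<bar>i\<bar> \<le> int k" if "U i \<noteq> UNIV" for i
  proof -
    have "nat \<bar>i\<bar> \<le> k" unfolding k_def using U(1) that by (intro Max_ge) auto
    then show ?thesis by linarith
  qed
  have "y \<in> T" if "\<forall>i. \<bar>i\<bar> \<le> int k \<longrightarrow> y i = x i" for y
  proof -
    have "y i \<in> U i" for i
      using k[of i] that U(2) by (cases "U i = UNIV") (auto simp: PiE_iff)
    then show ?thesis using U(3) by (auto simp: PiE_iff subset_iff)
  qed
  then show ?thesis by blast
qed

text \<open>A Lebesgue number lemma with cylinders in place of balls. Finitely many cylinders cover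
  \<open>Y\<close>, and the largest of their radii works for all points: if \<open>x\<close> lies in
  a cylinder, every cylinder around \<open>x\<close> of at least that radius is contained in it, so
  no radius has to be halved.\<close>

lemma cylinder_refinement:
  assumes comp: "compactin full_shift Y"
    and f: "continuous_map (subtopology full_shift Y) Z f" and V: "open_cover Z \<V>"
  obtains k :: nat where
    "\<And>x. x \<in> Y \<Longrightarrow> \<exists>V\<in>\<V>. \<forall>y\<in>Y. (\<forall>i. \<bar>i\<bar> \<le> int k \<longrightarrow> y i = x i) \<longrightarrow> f y \<in> V"
proof -
  define cyl :: "nat \<Rightarrow> bisequence \<Rightarrow> bisequence set" where "cyl k x = {y. \<forall>i. \<bar>i\<bar> \<le> int k \<longrightarrow> y i = x i}" for k x
  have self: "x \<in> cyl k x" for k x by (simp add: cyl_def)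
  define refined where "refined k x \<longleftrightarrow> (\<exists>V\<in>\<V>. \<forall>y\<in>Y. y \<in> cyl k x \<longrightarrow> f y \<in> V)" for k x
  have "\<exists>k. refined k x" if x: "x \<in> Y" for x
  proof -
    have "f x \<in> topspace Z" using continuous_map_in_topspace[OF f] x by simp
    then obtain V where V': "V \<in> \<V>" "f x \<in> V" using open_cover_covers[OF V] by blast
    have "openin (subtopology full_shift Y) {y \<in> topspace (subtopology full_shift Y). f y \<in> V}"
      by (rule openin_continuous_map_preimage[OF f open_cover_openin[OF V V'(1)]])
    then obtain T where T: "openin full_shift T" "{y \<in> topspace (subtopology full_shift Y). f y \<in> V} = T \<inter> Y"
      unfolding openin_subtopology by (elim exE conjE)
    have TV: "y \<in> T \<longleftrightarrow> f y \<in> V" if "y \<in> Y" for y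
      using that T(2)[unfolded set_eq_iff, rule_format, of y] by simp
    have "x \<in> T" using TV[OF x] V'(2) by simp
    then have "\<exists>k. \<forall>y. y \<in> cyl k x \<longrightarrow> y \<in> T" using cylinder_basis[OF T(1)] by (simp add: cyl_def)
    then obtain k where "\<forall>y. y \<in> cyl k x \<longrightarrow> y \<in> T" by (elim exE)
    then have "\<forall>y\<in>Y. y \<in> cyl k x \<longrightarrow> f y \<in> V" using TV by auto
    with V'(1) show ?thesis unfolding refined_def by blast
  qed
  then obtain k where k: "\<And>x. x \<in> Y \<Longrightarrow> refined (k x) x" by metis
  have ex: "\<exists>\<F>. finite \<F> \<and> \<F> \<subseteq> (\<lambda>x. cyl (k x) x) ` Y \<and> Y \<subseteq> \<Union>\<F>"
  proof (rule compactinD[OF comp])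
    show "openin full_shift U" if "U \<in> (\<lambda>x. cyl (k x) x) ` Y" for U
      using that openin_cylinder unfolding cyl_def by auto
    show "Y \<subseteq> \<Union>((\<lambda>x. cyl (k x) x) ` Y)" using self by blast
  qed
  obtain \<F> where \<F>: "finite \<F>" "\<F> \<subseteq> (\<lambda>x. cyl (k x) x) ` Y" "Y \<subseteq> \<Union>\<F>"
    using ex by (elim exE conjE)
  obtain F where F: "finite F" "F \<subseteq> Y" "Y \<subseteq> (\<Union>x\<in>F. cyl (k x) x)"
    using finite_subset_image[OF \<F>(1,2)] \<F>(3) by blast
  define K where "K = Max (insert 0 (k ` F))"
  have K: "k x \<le> K" if "x \<in> F" for x unfolding K_def using F(1) that by (intro Max_ge) auto
  show thesis
  proof (rule that[of K])
    fix x assume "x \<in> Y"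
    then obtain x' where x': "x' \<in> F" "x \<in> cyl (k x') x'" using F(3) by blast
    obtain V where V: "V \<in> \<V>" "\<And>y. y \<in> Y \<Longrightarrow> y \<in> cyl (k x') x' \<Longrightarrow> f y \<in> V"
      using k[of x'] x'(1) F(2) unfolding refined_def by blast
    have "y \<in> cyl (k x') x'" if y: "\<forall>i. \<bar>i\<bar> \<le> int K \<longrightarrow> y i = x i" for y
    proof -
      have "y i = x' i" if "\<bar>i\<bar> \<le> int (k x')" for i
        using y x'(2) K[OF x'(1)] that by (auto simp: cyl_def)
      then show ?thesis by (simp add: cyl_def)
    qed
    then show "\<exists>V\<in>\<V>. \<forall>y\<in>Y. (\<forall>i. \<bar>i\<bar> \<le> int K \<longrightarrow> y i = x i) \<longrightarrow> f y \<in> V"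
      using V by (intro bexI[of _ V]) auto
  qed
qed

section \<open>Entropy of the suspension\<close>

context shift_suspension
begin

abbreviation "Y \<equiv> insert (\<lambda>_. True) X"

lemma translate_mem_Y: "x \<in> Y \<Longrightarrow> translate k x \<in> Y"
  using translate_mem by auto

text \<open>The cross-section at height 0, extended over the all-ones sequence by \<Delta>. Profiles
  are zero there, so the extension is continuous on a compact set and
  \<open>cylinder_refinement\<close> applies.\<close>

definition base :: "bisequence \<Rightarrow> (bisequence \<times> real) set option" where
  "base x = (if x = (\<lambda>_. True) then None else spoint X roof (x, 0))"

lemma
  assumes "x \<in> Y"
  shows base_mem: "base x \<in> topspace Z"
    and profile_base: "profile (base x) s = bump x (s / c)"
proof -
  have "(x, 0) \<in> R" if "x \<noteq> (\<lambda>_. True)" using assms that c_pos by (simp add: region_iff)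
  then show "base x \<in> topspace Z" "profile (base x) s = bump x (s / c)"
    by (auto simp: base_def topspace_Z profile_spoint code_def)
qed

lemma continuous_map_base: "continuous_map (subtopology full_shift Y) Z base"
proof (rule continuous_map_into_Z)
  show "base x \<in> topspace Z" if "x \<in> topspace (subtopology full_shift Y)" for x
    using that by (intro base_mem) simp
  show "continuous_map (subtopology full_shift Y) euclideanreal (\<lambda>x. profile (base x) r)" for r
    by (rule continuous_map_eq[OF continuous_map_from_subtopology[OF continuous_map_bump]])
      (simp add: profile_base)
qed

lemma translation_base:
  assumes "x \<in> Y"
  shows "translation (real n * c) (base x) = base (translate (int n) x)"
proof (rule translation_eqI)
  fix s
  have "(s + real n * c) / c = s / c + of_int (int n)" using c_pos by (simp add: field_simps)
  then show "profile (base (translate (int n) x)) s = profile (base x) (s + real n * c)"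
    using assms translate_mem_Y[OF assms] by (simp only: profile_base bump_add_int)
qed (use assms base_mem translate_mem_Y in blast)+

lemma translation_base_surj:
  assumes "z \<in> topspace Z"
  obtains x u where "x \<in> Y" "u \<in> {0..c}" "z = translation u (base x)"
  using assms
proof (cases rule: topspace_Z_cases)
  case 1
  show thesis
  proof (rule that)
    show "z = translation 0 (base (\<lambda>_. True))"
      using 1 by (intro translation_eqI[symmetric]) (simp_all add: base_def topspace_Z)
  qed (use c_pos in auto)
next
  case (2 x u)
  then have x: "x \<in> Y" "u \<in> {0..c}" by (auto simp: region_iff)
  show thesis
  proof (rule that[OF x])
    show "z = translation u (base x)"
      using 2 x(1) assms by (intro translation_eqI[symmetric])
        (simp_all add: base_mem profile_base profile_spoint code_def add.commute)
  qed
qed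

text \<open>A point is \<open>translation u (base x)\<close> with \<open>u\<close> in
  \<open>{0..c}\<close>. Its itinerary is controlled by the symbols of \<open>x\<close> on a window
  and by one of finitely many times \<open>s\<close> near \<open>u\<close>: the word fixes a set
  \<open>V\<close> for each shifted base point, and \<open>V\<close> with \<open>s\<close> fixes a
  member of \<open>\<U>\<close>. So \<open>N\<close> counts the times and \<open>k\<close> is the
  radius of the cylinders.\<close>

lemma cover_number_le_complexity:
  assumes U: "open_cover Z \<U>"
  obtains N k where "0 < N"
    "\<And>n. cover_number Z (iterated_join Z (translation c) \<U> n) \<le> N * complexity Y (n + 2 * k)"
proof -
  note \<Phi> = flow_translation
  obtain \<V> \<delta> where V: "open_cover Z \<V>" "\<delta> > 0"
    "\<And>V s. V \<in> \<V> \<Longrightarrow> s \<in> {0..c} \<Longrightarrow> \<exists>U\<in>\<U>. \<forall>z\<in>V. \<forall>r. \<bar>r - s\<bar> < \<delta> \<longrightarrow> translation r z \<in> U"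
    by (rule flow_uniform_cover[OF \<Phi> U, of c]) (rule that)
  obtain k :: nat where
    k: "\<And>x. x \<in> Y \<Longrightarrow> \<exists>V\<in>\<V>. \<forall>y\<in>Y. (\<forall>i. \<bar>i\<bar> \<le> int k \<longrightarrow> y i = x i) \<longrightarrow> base y \<in> V"
    by (rule cylinder_refinement[OF compact_insert continuous_map_base V(1)]) (rule that)
  obtain F where F: "F \<subseteq> {0..c}" "finite F" "{0..c} \<subseteq> (\<Union>s\<in>F. ball s \<delta>)"
  proof (rule compactE_image[of "{0..c}" "{0..c}" "\<lambda>s. ball s \<delta>"])
    show "{0..c} \<subseteq> (\<Union>s\<in>{0..c}. ball s \<delta>)" using V(2) by (intro subsetI UN_I) auto
  qed auto
  have "F \<noteq> {}" using F(3) c_pos by auto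
  have "cover_number Z (iterated_join Z (translation c) \<U> n) \<le> card F * complexity Y (n + 2 * k)" for n
  proof -
    \<comment> \<open>The symbols of \<open>x\<close> at the positions from \<open>- k\<close> to
      \<open>n + k - 1\<close>, enough to see radius \<open>k\<close> around each of the positions
      below \<open>n\<close>.\<close>
    define w where "w x = initial_word (n + 2 * k) (translate (- int k) x)" for x
    define I where "I = F \<times> initial_word (n + 2 * k) ` Y"
    define A where "A = (\<lambda>(s, v). {translation u (base x) | u x. \<bar>u - s\<bar> < \<delta> \<and> x \<in> Y \<and> w x = v})"
    have w: "w x \<in> initial_word (n + 2 * k) ` Y" if "x \<in> Y" for x
      unfolding w_def using translate_mem_Y[OF that] by (rule imageI)
    have agree: "translate (int i) y j = translate (int i) x j"
      if "w y = w x" "i < n" "\<bar>j\<bar> \<le> int k" for x y i j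
    proof -
      have "nat (int i + j + int k) < n + 2 * k" using that(2,3) by linarith
      then have "translate (- int k) y (int (nat (int i + j + int k))) = translate (- int k) x (int (nat (int i + j + int k)))"
        using that(1) unfolding w_def initial_word_eq_iff by blast
      moreover have "int (nat (int i + j + int k)) = int i + j + int k" using that(3) by linarith
      ultimately show ?thesis by (simp add: translate_def add.commute)
    qed
    have "cover_number Z (iterated_join Z (translation c) \<U> n) \<le> card I"
    proof (rule cover_number_le[where S = A])
      show "finite I" unfolding I_def using F(2) finite_initial_words by blast
      show "\<Union>(iterated_join Z (translation c) \<U> n) = topspace Z"
        by (intro open_cover_Union open_cover_iterated_join flow_continuous \<Phi> U)
      show "topspace Z \<subseteq> (\<Union>i\<in>I. A i)"
      proof
        fix z assume "z \<in> topspace Z"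
        then obtain x u where x: "x \<in> Y" "u \<in> {0..c}" "z = translation u (base x)"
          by (rule translation_base_surj)
        obtain s where s: "s \<in> F" "u \<in> ball s \<delta>" using subsetD[OF F(3) x(2)] by (rule UN_E)
        then have us: "\<bar>u - s\<bar> < \<delta>" by (simp add: dist_real_def abs_minus_commute)
        have "(s, w x) \<in> I" unfolding I_def using s(1) w[OF x(1)] by (rule SigmaI)
        moreover have "z \<in> A (s, w x)" unfolding A_def using x(1,3) us by auto
        ultimately show "z \<in> (\<Union>i\<in>I. A i)" by blast
      qed
      fix p assume "p \<in> I"
      then obtain s v where p: "p = (s, v)" "s \<in> F" by (auto simp: I_def)
      show "A p = {} \<or> (\<exists>U\<in>iterated_join Z (translation c) \<U> n. A p \<subseteq> U)"
      proof (cases "\<exists>x\<in>Y. w x = v")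
        case True
        then obtain x where x: "x \<in> Y" "w x = v" by blast
        have "\<exists>U\<in>iterated_join Z (translation c) \<U> n. A p \<subseteq> U"
        proof (rule subset_iterated_join[OF \<Phi>])
          show "A p \<subseteq> topspace Z"
            unfolding p(1) A_def by (auto simp: base_mem translation_mem)
          fix i assume i: "i < n"
          obtain V where V': "V \<in> \<V>"
            "\<And>y. y \<in> Y \<Longrightarrow> (\<forall>j. \<bar>j\<bar> \<le> int k \<longrightarrow> y j = translate (int i) x j) \<Longrightarrow> base y \<in> V"
            using bexE[OF k[OF translate_mem_Y[OF x(1), of "int i"]]] by (metis (no_types))
          obtain U where U': "U \<in> \<U>" "\<And>z r. z \<in> V \<Longrightarrow> \<bar>r - s\<bar> < \<delta> \<Longrightarrow> translation r z \<in> U"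
            using bexE[OF V(3)[OF V'(1) subsetD[OF F(1) p(2)]]] by (metis (no_types))
          have "translation (real i * c) z \<in> U" if z: "z \<in> A p" for z
          proof -
            obtain u y where y: "z = translation u (base y)" "\<bar>u - s\<bar> < \<delta>" "y \<in> Y" "w y = v"
              using z unfolding p(1) A_def by auto
            \<comment> \<open>The flow commutes with itself: the full turns act on the base point as
              shifts, and the offset \<open>u\<close> is applied last.\<close>
            have "translation (real i * c) z = translation u (translation (real i * c) (base y))"
              unfolding y(1) using flow_add[OF \<Phi> base_mem[OF y(3)]] by (simp add: add.commute)
            also have "\<dots> = translation u (base (translate (int i) y))"
              by (simp only: translation_base[OF y(3)])
            also have "\<dots> \<in> U"
              using agree[of y x i] x(2) y(4) i
              by (intro U'(2) V'(2) y(2) translate_mem_Y[OF y(3)]) simp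
            finally show ?thesis .
          qed
          with U'(1) show "\<exists>U\<in>\<U>. \<forall>z\<in>A p. translation (real i * c) z \<in> U" by blast
        qed
        then show ?thesis ..
      qed (auto simp: p(1) A_def)
    qed
    then show ?thesis by (simp add: I_def card_cartesian_product complexity_def)
  qed
  moreover have "0 < card F" using F(2) \<open>F \<noteq> {}\<close> by (simp add: card_gt_0_iff)
  ultimately show thesis by (intro that)
qed

text \<open>\<open>N\<close> and \<open>k\<close> depend on the cover but not on \<open>n\<close>,
  so in the logarithm they cost only an additive constant.\<close>

lemma entropy_translation_le:
  assumes "growth Y \<le> ereal h"
  shows "topological_entropy Z (translation c) \<le> ereal h"
  unfolding topological_entropy_def
proof (rule SUP_least)
  fix \<U> assume "\<U> \<in> {\<U>. open_cover Z \<U>}"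
  then have U: "open_cover Z \<U>" by simp
  obtain N k where N: "0 < N"
    "\<And>n. cover_number Z (iterated_join Z (translation c) \<U> n) \<le> N * complexity Y (n + 2 * k)"
    by (rule cover_number_le_complexity[OF U]) (rule that)
  show "cover_entropy Z (translation c) \<U> \<le> ereal h"
  proof (rule cover_entropy_le)
    fix \<epsilon> :: real assume "0 < \<epsilon>"
    then have "growth Y < ereal (h + \<epsilon>)"
      by (intro le_less_trans[OF assms]) simp
    from Limsup_lessD[OF this[unfolded growth_def]] eventually_gt_at_top[of 0]
    have "eventually (\<lambda>n. ln (real (cover_number Z (iterated_join Z (translation c) \<U> n)))
        \<le> (h + \<epsilon>) * real n + (ln (real N) + real (2 * k) * ln 2)) sequentially"
    proof eventually_elim
      case (elim n)
      have pos: "0 < cover_number Z (iterated_join Z (translation c) \<U> n)"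
        by (intro cover_number_pos compact_space_Z open_cover_iterated_join flow_continuous
            flow_translation U) (simp add: topspace_Z)
      have "cover_number Z (iterated_join Z (translation c) \<U> n) \<le> N * (complexity Y n * 2 ^ (2 * k))"
        by (rule order_trans[OF N(2) mult_le_mono2[OF complexity_add_le]])
      from of_nat_mono[OF this, where 'a = real]
      have "real (cover_number Z (iterated_join Z (translation c) \<U> n))
          \<le> real N * (real (complexity Y n) * 2 ^ (2 * k))"
        by (simp only: of_nat_mult of_nat_power of_nat_numeral)
      then have "ln (real (cover_number Z (iterated_join Z (translation c) \<U> n)))
          \<le> ln (real N * (real (complexity Y n) * 2 ^ (2 * k)))"
        using pos by (subst ln_le_cancel_iff) auto
      also have "\<dots> = ln (real N) + (ln (real (complexity Y n)) + real (2 * k) * ln 2)"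
        using N(1) complexity_pos[of Y n] by (simp add: ln_mult ln_realpow)
      also have "ln (real (complexity Y n)) \<le> (h + \<epsilon>) * real n"
        using elim by (simp add: pos_divide_less_eq)
      finally show ?case by linarith
    qed
    then show "\<exists>C. eventually (\<lambda>n. ln (real (cover_number Z (iterated_join Z (translation c) \<U> n)))
        \<le> (h + \<epsilon>) * real n + C) sequentially" by blast
  qed
qed

text \<open>The value of the profile at \<open>c / 2\<close> reads off the symbol at 0 of a base point.\<close>

lemma growth_le_entropy_translation: "growth Y \<le> topological_entropy Z (translation c)"
proof -
  note \<Phi> = flow_translation
  \<comment> \<open>The sets overlap where the value lies strictly between 0 and 1/2, so both can be
    open. A base point has value 0 or 1/2 there and belongs to exactly one of them.\<close>
  define O0 where "O0 = {z \<in> topspace Z. profile z (c / 2) \<in> {0<..}}"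
  define O1 where "O1 = {z \<in> topspace Z. profile z (c / 2) \<in> {..<1 / 2}}"
  define \<U> where "\<U> = {O0, O1}"
  have "openin Z O0" "openin Z O1"
    unfolding O0_def O1_def by (rule openin_continuous_map_preimage[OF continuous_map_profile], simp)+
  moreover have "O0 \<union> O1 = topspace Z" by (auto simp: O0_def O1_def)
  ultimately have U: "open_cover Z \<U>" by (auto simp: \<U>_def open_cover_def)
  have at0: "base x \<in> O0 \<longleftrightarrow> \<not> x 0" "base x \<in> O1 \<longleftrightarrow> x 0" if "x \<in> Y" for x
  proof -
    have "profile (base x) (c / 2) = (if x 0 then 0 else 1 / 2)"
      using bump_half[of x 0] c_pos by (simp add: profile_base[OF that])
    then show "base x \<in> O0 \<longleftrightarrow> \<not> x 0" "base x \<in> O1 \<longleftrightarrow> x 0"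
      using base_mem[OF that] by (auto simp: O0_def O1_def)
  qed
  have at: "(translation c ^^ i) (base x) \<in> O0 \<longleftrightarrow> \<not> x (int i)"
    "(translation c ^^ i) (base x) \<in> O1 \<longleftrightarrow> x (int i)" if "x \<in> Y" for x i
    unfolding flow_funpow[OF \<Phi> base_mem[OF that]] translation_base[OF that]
      at0[OF translate_mem_Y[OF that]] by (simp_all add: translate_def)
  have le: "complexity Y n \<le> cover_number Z (iterated_join Z (translation c) \<U> n)" for n
  proof -
    obtain \<W> where W: "\<W> \<subseteq> iterated_join Z (translation c) \<U> n" "finite \<W>"
      "card \<W> = cover_number Z (iterated_join Z (translation c) \<U> n)" "\<Union>\<W> = topspace Z"
      by (rule cover_number_attained[OF compact_space_Z
            open_cover_iterated_join[OF flow_continuous[OF \<Phi>] U]]) (rule that)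
    \<comment> \<open>The base points in one member of the join share their initial word, so a
      subcover needs at least one member for each word.\<close>
    have same: "initial_word n x = initial_word n y"
      if W': "W \<in> \<W>" and x: "x \<in> Y" "base x \<in> W" and y: "y \<in> Y" "base y \<in> W" for x y W
      unfolding initial_word_eq_iff
    proof (intro allI impI)
      fix i assume i: "i < n"
      obtain d where d: "W = {z \<in> topspace Z. \<forall>i<n. (translation c ^^ i) z \<in> d i}" "\<forall>i<n. d i \<in> \<U>"
        using W(1) W' unfolding iterated_join_def by auto
      have "(translation c ^^ i) (base x) \<in> d i" "(translation c ^^ i) (base y) \<in> d i"
        using x(2) y(2) i unfolding d(1) by auto
      moreover have "d i = O0 \<or> d i = O1" using d(2) i by (auto simp: \<U>_def)
      ultimately show "x (int i) = y (int i)" using at[OF x(1)] at[OF y(1)] by auto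
    qed
    have "\<forall>v\<in>initial_word n ` Y. \<exists>W. W \<in> \<W> \<and> (\<exists>x\<in>Y. initial_word n x = v \<and> base x \<in> W)"
    proof
      fix v assume "v \<in> initial_word n ` Y"
      then obtain x where x: "x \<in> Y" "initial_word n x = v" by blast
      have "base x \<in> \<Union>\<W>" unfolding W(4) by (rule base_mem[OF x(1)])
      then obtain W where "W \<in> \<W>" "base x \<in> W" by (rule UnionE)
      with x show "\<exists>W. W \<in> \<W> \<and> (\<exists>x\<in>Y. initial_word n x = v \<and> base x \<in> W)" by blast
    qed
    from bchoice[OF this] obtain g where
      g: "\<And>v. v \<in> initial_word n ` Y \<Longrightarrow> g v \<in> \<W> \<and> (\<exists>x\<in>Y. initial_word n x = v \<and> base x \<in> g v)"
      by blast
    have "inj_on g (initial_word n ` Y)"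
    proof (rule inj_onI)
      fix v v' assume v: "v \<in> initial_word n ` Y" "v' \<in> initial_word n ` Y" "g v = g v'"
      obtain x where x: "x \<in> Y" "initial_word n x = v" "base x \<in> g v" using g[OF v(1)] by blast
      obtain x' where x': "x' \<in> Y" "initial_word n x' = v'" "base x' \<in> g v" using g[OF v(2)] v(3) by auto
      have "g v \<in> \<W>" using g[OF v(1)] by blast
      from same[OF this x(1,3) x'(1,3)] show "v = v'" using x(2) x'(2) by simp
    qed
    moreover have "g ` initial_word n ` Y \<subseteq> \<W>" using g by blast
    ultimately have "card (initial_word n ` Y) \<le> card \<W>" by (rule card_inj_on_le[OF _ _ W(2)])
    with W(3) show ?thesis by (simp add: complexity_def)
  qed
  have "growth Y \<le> cover_entropy Z (translation c) \<U>"
    unfolding growth_def cover_entropy_def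
  proof (intro Limsup_mono always_eventually allI)
    fix n
    have "ln (real (complexity Y n)) \<le> ln (real (cover_number Z (iterated_join Z (translation c) \<U> n)))"
      using le[of n] complexity_pos[of Y n] by simp
    then show "ereal (ln (real (complexity Y n)) / real n)
        \<le> ereal (ln (real (cover_number Z (iterated_join Z (translation c) \<U> n))) / real n)"
      by (simp add: divide_right_mono)
  qed
  also have "\<dots> \<le> topological_entropy Z (translation c)"
    by (rule cover_entropy_le_topological_entropy[OF U])
  finally show ?thesis .
qed

text \<open>The time-\<open>c\<close> map is squeezed to entropy \<open>h\<close>. Scaling from
  \<open>c\<close> to 1 gives the upper bound; for the lower one, a time-1 entropy below
  \<open>h / c\<close> would scale back to a time-\<open>c\<close> entropy below
  \<open>h\<close>.\<close>

lemma flow_entropy_translation: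
  assumes h: "growth Y = ereal h" and "0 < h"
  shows "flow_entropy Z translation = ereal (h / c)"
proof (rule antisym)
  note \<Phi> = flow_translation
  have "topological_entropy Z (translation c) \<le> ereal h"
    by (rule entropy_translation_le) (simp add: h)
  from flow_entropy_scaling_le[OF \<Phi> _ c_pos this, of 1] assms(2)
  show "flow_entropy Z translation \<le> ereal (h / c)" by (simp add: flow_entropy_def)
  show "ereal (h / c) \<le> flow_entropy Z translation"
  proof (rule ccontr)
    assume "\<not> ereal (h / c) \<le> flow_entropy Z translation"
    then have less: "topological_entropy Z (translation 1) < ereal (h / c)"
      by (simp add: flow_entropy_def)
    obtain r where r: "topological_entropy Z (translation 1) < ereal r" "ereal r < ereal (h / c)"
      using ereal_dense2[OF less] by blast
    \<comment> \<open>The scaling inequality takes a real, nonnegative bound; since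
      \<open>h / c\<close> is positive, cutting off at 0 stays below it.\<close>
    define r' where "r' = max r 0"
    have r': "r' < h / c" "0 \<le> r'" using r(2) assms(2) c_pos by (auto simp: r'_def)
    have "topological_entropy Z (translation 1) \<le> ereal r'"
      using r(1) by (rule order_trans[OF less_imp_le]) (simp add: r'_def)
    from flow_entropy_scaling_le[OF \<Phi> c_pos _ this r'(2)]
    have "topological_entropy Z (translation c) \<le> ereal (c * r')" by simp
    with growth_le_entropy_translation have "h \<le> c * r'" unfolding h by (metis ereal_less_eq(3) order_trans)
    with r'(1) c_pos show False by (simp add: field_simps)
  qed
qed

end

section \<open>Ohno's subshift\<close>

lemma
  assumes "ohno_words x x'"
  shows ohno_words_1: "x 1 = [Some True, None]"
    and ohno_words_Suc: "n \<ge> 1 \<Longrightarrow> x (Suc n) = x n @ x' n @ x n"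
    and ohno_words_tilde: "n \<ge> 1 \<Longrightarrow> \<exists>i<length (x n). x n ! i = None \<and> x' n = (x n)[i := Some True]"
proof -
  note * = assms[unfolded ohno_words_def]
  show "x 1 = [Some True, None]" by (rule conjunct1[OF *])
  show "n \<ge> 1 \<Longrightarrow> x (Suc n) = x n @ x' n @ x n"
    by (rule conjunct1[OF conjunct2[OF conjunct2[OF *]], rule_format])
  show "n \<ge> 1 \<Longrightarrow> \<exists>i<length (x n). x n ! i = None \<and> x' n = (x n)[i := Some True]"
    by (rule conjunct1[OF conjunct2[OF conjunct2[OF conjunct2[OF *]], rule_format]])
qed

text \<open>Positive starting positions are kept because there \<open>two_sided z\<close> agrees
  with \<open>z\<close>, so every filling becomes a subword of the two-sided point.\<close>

lemma ohno_filling_words: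
  assumes "ohno_filling x y z" and n: "n \<ge> 1"
  obtains S where "\<And>s. s \<in> S \<Longrightarrow> 0 < s" "(\<lambda>s. map z [s..<s + length (x n)]) ` S = fillings (x n)"
proof -
  have "\<exists>S. (\<forall>s\<in>S. 0 < s) \<and> (\<lambda>s. map z [s..<s + length (x n)]) ` S = fillings (x n)"
    using conjunct2[OF assms(1)[unfolded ohno_filling_def]]
    by (elim exE conjE allE[of _ n] impE[OF _ n])
      (rule exI, rule conjI[rotated], assumption, rule ballI, drule (1) bspec, erule conjE, erule le_less_trans[OF le0])
  then obtain S where S: "(\<forall>s\<in>S. 0 < s) \<and> (\<lambda>s. map z [s..<s + length (x n)]) ` S = fillings (x n)"
    by (elim exE)
  show thesis by (rule that[OF bspec[OF conjunct1[OF S]] conjunct2[OF S]])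
qed

text \<open>A step triples the length \<open>l\<close> and turns \<open>p\<close> placeholders into
  \<open>3 * p - 1\<close>, as the middle block has lost one. The summand 2 is what makes
  \<open>l + 2 \<le> 4 * p\<close> pass through the induction. The bound
  \<open>n < length (x n)\<close> makes the lengths exceed any given number.\<close>

lemma ohno_word_length_placeholders:
  assumes "ohno_words x x'" "n \<ge> 1"
  shows "n < length (x n)" "length (x n) + 2 \<le> 4 * count_list (x n) None"
proof -
  have len: "length (x' n) = length (x n)" "Suc (count_list (x' n) None) = count_list (x n) None"
    if n: "n \<ge> 1" for n
  proof -
    obtain i where i: "i < length (x n)" "x n ! i = None" "x' n = (x n)[i := Some True]"
      using ohno_words_tilde[OF assms(1) n] by (elim exE conjE)
    show "length (x' n) = length (x n)" by (simp add: i)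
    show "Suc (count_list (x' n) None) = count_list (x n) None"
      unfolding i(3) by (rule count_update[OF i(1,2)])
  qed
  have "n < length (x n) \<and> length (x n) + 2 \<le> 4 * count_list (x n) None"
    using assms(2)
  proof (induction n rule: dec_induct)
    case base
    show ?case unfolding ohno_words_1[OF assms(1)] by simp
  next
    case (step n)
    show ?case
      unfolding ohno_words_Suc[OF assms(1) step.hyps(1)] using len[OF step.hyps(1)] step.IH by simp
  qed
  then show "n < length (x n)" "length (x n) + 2 \<le> 4 * count_list (x n) None" by simp_all
qed

lemma growth_ohno:
  assumes "ohno_point xs"
  obtains h where "growth (insert (\<lambda>_. True) (orbit_closure xs)) = ereal h" "0 < h"
proof -
  let ?Y = "insert (\<lambda>_. True) (orbit_closure xs)"
  obtain x x' y z where ohno: "ohno_words x x'" "ohno_filling x y z" "xs = two_sided z"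
    using assms unfolding ohno_point_def by (elim exE conjE)
  have words: "2 ^ count_list (x n) None \<le> complexity ?Y (length (x n))" if n: "n \<ge> 1" for n
  proof -
    obtain S where S: "\<And>s. s \<in> S \<Longrightarrow> 0 < s"
      "(\<lambda>s. map z [s..<s + length (x n)]) ` S = fillings (x n)"
      by (rule ohno_filling_words[OF ohno(2) n]) (rule that)
    have "fillings (x n) \<subseteq> initial_word (length (x n)) ` ?Y"
    proof
      fix w assume "w \<in> fillings (x n)"
      then have "w \<in> (\<lambda>s. map z [s..<s + length (x n)]) ` S" by (simp only: S(2))
      then obtain s where s: "s \<in> S" "w = map z [s..<s + length (x n)]" by (elim imageE)
      have "w = initial_word (length (x n)) (translate (int s) xs)"
      proof (rule nth_equalityI)
        fix i assume "i < length w"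
        then have i: "i < length (x n)" by (simp add: s)
        have "nat (int i + int s) = s + i" "int i + int s \<noteq> 0" using S(1)[OF s(1)] by auto
        then show "w ! i = initial_word (length (x n)) (translate (int s) xs) ! i"
          using i by (simp add: s initial_word_def translate_def ohno(3) two_sided_def)
      qed (simp add: s initial_word_def)
      then show "w \<in> initial_word (length (x n)) ` ?Y"
        by (rule image_eqI[OF _ insertI2[OF translate_mem_orbit_closure]])
    qed
    then have "card (fillings (x n)) \<le> complexity ?Y (length (x n))"
      unfolding complexity_def by (rule card_mono[OF finite_initial_words])
    then show ?thesis using card_fillings[of "x n"] by simp
  qed
  \<comment> \<open>Many words are known only at the lengths of the \<open>x n\<close>. A limit
    superior below \<open>ln 2 / 4\<close> would bound the rate at all large lengths, in particular
    at one of these.\<close>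
  have "ereal (ln 2 / 4) \<le> growth ?Y"
  proof (rule ccontr)
    assume "\<not> ereal (ln 2 / 4) \<le> growth ?Y"
    then have "growth ?Y < ereal (ln 2 / 4)" by (simp only: not_le)
    from Limsup_lessD[OF this[unfolded growth_def]]
    have "\<exists>m. \<forall>n\<ge>m. ln (real (complexity ?Y n)) / real n < ln 2 / 4"
      by (simp only: eventually_sequentially less_ereal.simps(1))
    then obtain m where
      m: "\<And>n. m \<le> n \<Longrightarrow> ln (real (complexity ?Y n)) / real n < ln 2 / 4" by blast
    define n where "n = Suc m"
    define L where "L = length (x n)"
    have L: "n < L" "L + 2 \<le> 4 * count_list (x n) None"
      unfolding L_def by (rule ohno_word_length_placeholders[OF ohno(1)]; simp add: n_def)+
    have "real L * (ln 2 / 4) \<le> real (count_list (x n) None) * ln 2"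
    proof -
      have "real L / 4 \<le> real (count_list (x n) None)" using L(2) by linarith
      from mult_right_mono[OF this, of "ln 2"] show ?thesis by simp
    qed
    also have "\<dots> = ln (real (2 ^ count_list (x n) None))" by (simp add: ln_realpow)
    also have "\<dots> \<le> ln (real (complexity ?Y L))"
    proof (rule ln_mono)
      show "real (2 ^ count_list (x n) None) \<le> real (complexity ?Y L)"
        unfolding L_def of_nat_le_iff by (rule words) (simp add: n_def)
    qed simp
    also have "\<dots> < ln 2 / 4 * real L"
      using m[of L] L(1) by (simp add: n_def pos_divide_less_eq)
    finally show False by (simp add: mult.commute)
  qed
  moreover have "growth ?Y \<le> ereal (ln 2)"
    unfolding growth_def
  proof (intro Limsup_bounded always_eventually allI)
    fix n
    have "real (complexity ?Y n) \<le> 2 ^ n"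
      using of_nat_mono[OF complexity_le[of ?Y n], where 'a = real] by (simp only: of_nat_power of_nat_numeral)
    then have "ln (real (complexity ?Y n)) \<le> ln (2 ^ n)"
      using complexity_pos[of ?Y n] by (subst ln_le_cancel_iff) auto
    also have "\<dots> = real n * ln 2" by (simp add: ln_realpow)
    \<comment> \<open>At \<open>n = 0\<close> the quotient is 0 by the convention for division by
      0.\<close>
    finally show "ereal (ln (real (complexity ?Y n)) / real n) \<le> ereal (ln 2)"
      by (cases "n = 0") (simp_all add: pos_divide_le_eq mult.commute)
  qed
  ultimately obtain h where h: "growth ?Y = ereal h" "ln 2 / 4 \<le> h"
    by (cases "growth ?Y") simp_all
  have "0 < (ln 2 / 4 :: real)" by simp
  then have "0 < h" using h(2) by (rule less_le_trans)
  with h(1) show thesis by (rule that)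
qed

theorem theoremB:
  fixes xs :: bisequence and b :: real
  assumes "ohno_point xs"
    and "0 < b"
  shows "\<exists>\<gamma> \<Phi>. roof_function (orbit_closure xs) \<gamma> \<and>
           suspension_flow (orbit_closure xs) \<gamma> \<Phi> \<and>
           flow_entropy (compact_suspension (orbit_closure xs) \<gamma>) \<Phi> = ereal b"
proof -
  obtain h where h: "growth (insert (\<lambda>_. True) (orbit_closure xs)) = ereal h" "0 < h"
    by (rule growth_ohno[OF assms(1)])
  have "compactin full_shift (orbit_closure xs)"
    unfolding orbit_closure_def by (intro closedin_compact_space compact_space_full_shift closedin_closure_of)
  moreover have "compactin full_shift {\<lambda>_. True}" by (intro finite_imp_compactin) auto
  ultimately have "compactin full_shift (insert (\<lambda>_. True) (orbit_closure xs))"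
    using compactin_Un by fastforce
  then interpret shift_suspension "orbit_closure xs" "h / b"
    using h(2) assms(2) translate_orbit_closure by unfold_locales auto
  have "flow_entropy Z translation = ereal b"
    using flow_entropy_translation[OF h] h(2) assms(2) by simp
  with roof_function_const suspension_flow_translation show ?thesis by blast
qed

end
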